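(* Let $X$ be a locally compact Hausdorff space, let $E$ be a monotone complete and normal partially ordered vector space, and let $\pi:\mathrm{C}_{\mathrm c}(X)\to E$ be a positive operator such that $\{\pi(f): f\in\mathrm{C}_{\mathrm c}(X)^+,\ \lVert f\rVert\leq 1\}$ is bounded above in $E$; this is automatically the case if $X$ is compact. Then there exists a unique regular Borel measure $\mu:\mathscr{B}\to\overline{E^+}$ on the Borel $\sigma$-algebra $\mathscr{B}$ of $X$ such that \[ \pi(f)=\int_X^{\mathrm{o}} f\,\mathrm{d}\mu \] for all $f\in\mathrm{C}_{\mathrm c}(X)$. The measure $\mu$ is finite. If $V$ is a non-empty open subset of $X$, then \[ \mu(V)=\bigvee\{\pi(f): f\prec V\} \] in $E$. If $K$ is a compact subset of $X$, then \[ \mu(K)=\bigwedge\{\pi(f): K\prec f\} \] in $E$.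
   Context: Ordered spaces. Vector spaces are real; operators and functionals are linear. A partially ordered vector space $E$ has a proper positive cone $E^+$, which need not be generating. $E$ is monotone complete if every increasing net in $E$ that is bounded above has a supremum in $E$. An operator between partially ordered vector spaces is positive if it maps the positive cone into the positive cone. A positive functional $x'$ on $E$ is order continuous if $(x_\lambda,x')\downarrow 0$ for every net $x_\lambda\downarrow0$ in $E$ (decreasing with infimum $0$). $E_{\mathrm{oc}}^{\sim}$ is the space of differences of positive order continuous functionals, and $(E_{\mathrm{oc}}^{\sim})^+$ is the set of positive order continuous functionals. $E$ is normal if, for $x\in E$, one has $(x,x')\ge0$ for all $x'\in(E_{\mathrm{oc}}^{\sim})^+$ if and only if $x\in E^+$. Extended space. $\overline{E}=E\cup\{\infty\}$ (disjoint union), ordered by the order of $E$ and $x\le\infty$ for all $x\in\overline E$; $\overline{E^+}=E^+\cup\{\infty\}$; $\infty+x=x+\infty=\infty$; $r\cdot\infty=\infty$ for real $r>0$, $0\cdot\infty=0$. Elements of $E$ are called finite. Measures. A positive $\overline E$-valued measure on $\mathscr{B}$ is a map $\mu:\mathscr{B}\to\overline{E^+}$ with $\mu(\emptyset)=0$ and $\mu(\bigcup_n\Delta_n)=\bigvee_{N=1}^\infty\sum_{n=1}^N\mu(\Delta_n)$ in $\overline E$ for pairwise disjoint sequences $(\Delta_n)$ in $\mathscr{B}$. It is finite if $\mu(X)\in E^+$. Order integral. For a measurable $\varphi=\sum_{i=1}^n r_i\chi_{\Delta_i}\ge 0$ taking finitely many finite values ($r_i\in\mathbb{R}^+$, $\Delta_i\in\mathscr{B}$),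 $\int_X^{\mathrm o}\varphi\,\mathrm d\mu=\sum_i r_i\mu(\Delta_i)\in\overline{E^+}$. For measurable $f:X\to[0,\infty]$, $\int_X^{\mathrm o}f\,\mathrm d\mu=\bigvee_n\int_X^{\mathrm o}\varphi_n\,\mathrm d\mu$ in $\overline{E}$, for any sequence of such elementary functions $\varphi_n\uparrow f$ pointwise (independent of the choice). A measurable $f:X\to\mathbb{R}$ is integrable if $\int_X^{\mathrm o}|f|\,\mathrm d\mu$ is finite, and then $\int_X^{\mathrm o}f\,\mathrm d\mu=\int_X^{\mathrm o}f^+\,\mathrm d\mu-\int_X^{\mathrm o}f^-\,\mathrm d\mu$. Regularity. $\mu$ is a Borel measure if $\mu(K)\in E$ for all compact $K\subseteq X$; it is inner regular at $\Delta$ if $\mu(\Delta)=\bigvee\{\mu(K):K\text{ compact},K\subseteq\Delta\}$ in $\overline E$; outer regular at $\Delta$ if $\mu(\Delta)=\bigwedge\{\mu(V):V\text{ open},\Delta\subseteq V\}$ in $\overline E$. It is a regular Borel measure if it is a Borel measure that is inner regular at all open sets and outer regular at all Borel sets. Functions. $\mathrm{C}_{\mathrm c}(X)$ is the space of real-valued continuous functions on $X$ with compact support, with the pointwise order and the supremum norm. For $S\subseteq X$, $f\prec S$ means $f\in\mathrm{C}_{\mathrm c}(X)$, $0\le f\le 1$ and $\operatorname{supp}f\subseteq S$; $S\prec f$ means $f\in\mathrm{C}_{\mathrm c}(X)$, $0\le f\le 1$ and $f=1$ on $S$. *)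

theory Defs
  imports "HOL-Analysis.Analysis" "HOL-Library.Lub_Glb"
begin

section \<open>Nets, monotone completeness and normality\<close>

definition directed_index :: "'i set \<Rightarrow> ('i \<Rightarrow> 'i \<Rightarrow> bool) \<Rightarrow> bool" where
  "directed_index I r \<longleftrightarrow> I \<noteq> {} \<and> (\<forall>i\<in>I. r i i) \<and>
     (\<forall>i\<in>I. \<forall>j\<in>I. \<forall>k\<in>I. r i j \<longrightarrow> r j k \<longrightarrow> r i k) \<and>
     (\<forall>i\<in>I. \<forall>j\<in>I. \<exists>k\<in>I. r i k \<and> r j k)"

definition increasing_net :: "'i set \<Rightarrow> ('i \<Rightarrow> 'i \<Rightarrow> bool) \<Rightarrow> ('i \<Rightarrow> 'a::order) \<Rightarrow> bool" where
  "increasing_net I r x \<longleftrightarrow> directed_index I r \<and> (\<forall>i\<in>I. \<forall>j\<in>I. r i j \<longrightarrow> x i \<le> x j)"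

definition decreasing_net :: "'i set \<Rightarrow> ('i \<Rightarrow> 'i \<Rightarrow> bool) \<Rightarrow> ('i \<Rightarrow> 'a::order) \<Rightarrow> bool" where
  "decreasing_net I r x \<longleftrightarrow> directed_index I r \<and> (\<forall>i\<in>I. \<forall>j\<in>I. r i j \<longrightarrow> x j \<le> x i)"

definition decreases_to :: "'i set \<Rightarrow> ('i \<Rightarrow> 'i \<Rightarrow> bool) \<Rightarrow> ('i \<Rightarrow> 'a::order) \<Rightarrow> 'a \<Rightarrow> bool" where
  "decreases_to I r x l \<longleftrightarrow> decreasing_net I r x \<and> isGlb UNIV (x ` I) l"

text \<open>
  One cannot quantify over index types inside a definition, so the nets below are indexed by
  directed sets whose elements are drawn from the space itself. This is no restriction: a monotone
  net can be re-indexed by its range. The lemmas \<open>monotone_completeD\<close> and \<open>order_continuousD\<close>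
  give the properties for nets over an arbitrary index type.
\<close>

definition monotone_complete :: "'e::ordered_real_vector itself \<Rightarrow> bool" where
  "monotone_complete _ \<longleftrightarrow>
     (\<forall>(I::'e set) r (x::'e \<Rightarrow> 'e). increasing_net I r x \<longrightarrow> bdd_above (x ` I) \<longrightarrow>
        (\<exists>s. isLub UNIV (x ` I) s))"

definition positive_functional :: "('e::ordered_real_vector \<Rightarrow> real) \<Rightarrow> bool" where
  "positive_functional \<phi> \<longleftrightarrow> linear \<phi> \<and> (\<forall>x\<ge>0. 0 \<le> \<phi> x)"

definition order_continuous :: "('e::ordered_real_vector \<Rightarrow> real) \<Rightarrow> bool" where
  "order_continuous \<phi> \<longleftrightarrow>
     (\<forall>(I::'e set) r (x::'e \<Rightarrow> 'e). decreases_to I r x 0 \<longrightarrow> decreases_to I r (\<lambda>i. \<phi> (x i)) 0)"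

definition normal_space_order :: "'e::ordered_real_vector itself \<Rightarrow> bool" where
  "normal_space_order _ \<longleftrightarrow>
     (\<forall>x::'e. (\<forall>\<phi>. positive_functional \<phi> \<and> order_continuous \<phi> \<longrightarrow> 0 \<le> \<phi> x) \<longleftrightarrow> 0 \<le> x)"

lemma directed_index_range:
  assumes "directed_index I r" and "\<And>i j. i \<in> I \<Longrightarrow> j \<in> I \<Longrightarrow> r i j \<Longrightarrow> q (x i) (x j)"
    and "\<And>a. q a a" and "\<And>a b c. q a b \<Longrightarrow> q b c \<Longrightarrow> q a c"
  shows "directed_index (x ` I) q"
proof -
  have "\<exists>c\<in>x ` I. q a c \<and> q b c" if ab: "a \<in> x ` I" "b \<in> x ` I" for a b
  proof -
    from ab obtain i j where ij: "i \<in> I" "j \<in> I" "a = x i" "b = x j" by blast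
    moreover from ij assms(1) obtain k where "k \<in> I" "r i k" "r j k"
      unfolding directed_index_def by blast
    ultimately show ?thesis using assms(2) by blast
  qed
  moreover have "x ` I \<noteq> {}" using assms(1) unfolding directed_index_def by simp
  ultimately show ?thesis
    unfolding directed_index_def using assms(3,4) by blast
qed

lemma monotone_completeD:
  fixes x :: "'i \<Rightarrow> 'e::ordered_real_vector"
  assumes "monotone_complete TYPE('e)" and "increasing_net I r x" and "bdd_above (x ` I)"
  shows "\<exists>s. isLub UNIV (x ` I) s"
proof -
  have "directed_index (x ` I) (\<le>)"
    by (rule directed_index_range[where r = r]) (use assms(2) in \<open>auto simp: increasing_net_def\<close>)
  then have "increasing_net (x ` I) (\<le>) (\<lambda>e. e)"
    by (simp add: increasing_net_def)
  moreover have "(\<lambda>e. e) ` x ` I = x ` I" by simp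
  ultimately show ?thesis
    using assms(1,3) unfolding monotone_complete_def by metis
qed

lemma order_continuousD:
  fixes x :: "'i \<Rightarrow> 'e::ordered_real_vector"
  assumes "positive_functional \<phi>" "order_continuous \<phi>" "decreases_to I r x 0"
  shows "decreases_to I r (\<lambda>i. \<phi> (x i)) 0"
proof -
  have mono: "\<phi> a \<le> \<phi> b" if "a \<le> b" for a b
    using assms(1) that unfolding positive_functional_def
    by (metis diff_ge_0_iff_ge linear_diff)
  have "directed_index (x ` I) (\<lambda>a b. b \<le> a)"
    by (rule directed_index_range[where r = r])
      (use assms(3) in \<open>auto simp: decreases_to_def decreasing_net_def\<close>)
  then have "decreases_to (x ` I) (\<lambda>a b. b \<le> a) (\<lambda>e. e) 0"
    using assms(3) by (simp add: decreases_to_def decreasing_net_def)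
  then have "decreases_to (x ` I) (\<lambda>a b. b \<le> a) \<phi> 0"
    using assms(2) unfolding order_continuous_def by blast
  then show ?thesis
    using assms(3) mono by (simp add: decreases_to_def decreasing_net_def image_image)
qed


section \<open>The extended space\<close>

text \<open>
  \<open>'a extended\<close> from \<open>HOL-Library.Extended\<close> is not used because it also has an element
  \<open>-\<infinity>\<close>. The positive part \<open>E\<^sup>+ \<union> {\<infinity>}\<close> is \<open>{0..} :: 'e ext set\<close>.
\<close>

datatype 'a ext = Fin (the_fin: 'a) | Infty

instantiation ext :: (order) order
begin

fun less_eq_ext :: "'a ext \<Rightarrow> 'a ext \<Rightarrow> bool" where
  "Fin x \<le> Fin y \<longleftrightarrow> x \<le> y"
| "(_ :: 'a ext) \<le> Infty \<longleftrightarrow> True"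
| "Infty \<le> Fin _ \<longleftrightarrow> False"

definition less_ext :: "'a ext \<Rightarrow> 'a ext \<Rightarrow> bool" where
  "x < y \<longleftrightarrow> x \<le> y \<and> \<not> y \<le> (x :: 'a ext)"

instance
proof
  fix x y z :: "'a ext"
  show "x < y \<longleftrightarrow> x \<le> y \<and> \<not> y \<le> x" by (rule less_ext_def)
  show "x \<le> x" by (cases x) auto
  show "x \<le> z" if "x \<le> y" "y \<le> z" using that by (cases x; cases y; cases z) auto
  show "x = y" if "x \<le> y" "y \<le> x" using that by (cases x; cases y) auto
qed

end

instantiation ext :: (comm_monoid_add) comm_monoid_add
begin

definition zero_ext :: "'a ext" where "0 = Fin 0"

fun plus_ext :: "'a ext \<Rightarrow> 'a ext \<Rightarrow> 'a ext" where
  "Fin x + Fin y = Fin (x + y)"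
| "(_ :: 'a ext) + Infty = Infty"
| "Infty + Fin _ = Infty"

instance
proof
  fix x y z :: "'a ext"
  show "x + y + z = x + (y + z)" by (cases x; cases y; cases z) (auto simp: ac_simps)
  show "x + y = y + x" by (cases x; cases y) (auto simp: ac_simps)
  show "0 + x = x" by (cases x) (auto simp: zero_ext_def)
qed

end

text \<open>Only used for scalars \<open>r \<ge> 0\<close>.\<close>

fun ext_scale :: "real \<Rightarrow> 'a::real_vector ext \<Rightarrow> 'a ext" where
  "ext_scale r (Fin x) = Fin (r *\<^sub>R x)"
| "ext_scale r Infty = (if r = 0 then 0 else Infty)"


section \<open>Measures and the order integral\<close>

text \<open>
  A measure on the Borel sets is an element of \<open>sets borel \<rightarrow>\<^sub>E {0..}\<close>, i.e. it takes the fixed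
  value \<open>undefined\<close> off the Borel sets, so that measures are equal iff they agree on \<open>sets borel\<close>.
\<close>

definition ext_measure :: "('x::topological_space set \<Rightarrow> 'e::ordered_real_vector ext) \<Rightarrow> bool" where
  "ext_measure \<mu> \<longleftrightarrow> \<mu> \<in> sets borel \<rightarrow>\<^sub>E {0..} \<and> \<mu> {} = 0 \<and>
     (\<forall>A::nat \<Rightarrow> 'x set. range A \<subseteq> sets borel \<longrightarrow> disjoint_family A \<longrightarrow>
        isLub UNIV (range (\<lambda>N. \<Sum>n\<le>N. \<mu> (A n))) (\<mu> (\<Union>n. A n)))"

definition finite_ext_measure :: "('x::topological_space set \<Rightarrow> 'e::ordered_real_vector ext) \<Rightarrow> bool" where
  "finite_ext_measure \<mu> \<longleftrightarrow> ext_measure \<mu> \<and> \<mu> UNIV \<in> Fin ` {0..}"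

definition elementary :: "('x::topological_space \<Rightarrow> real) \<Rightarrow> bool" where
  "elementary \<phi> \<longleftrightarrow> simple_function borel \<phi> \<and> (\<forall>x. 0 \<le> \<phi> x)"

text \<open>As for \<open>integral\<^sup>S\<close>, the canonical representation of an elementary function is used.\<close>

definition elementary_integral ::
  "('x::topological_space set \<Rightarrow> 'e::ordered_real_vector ext) \<Rightarrow> ('x \<Rightarrow> real) \<Rightarrow> 'e ext" where
  "elementary_integral \<mu> \<phi> = (\<Sum>r\<in>range \<phi>. ext_scale r (\<mu> (\<phi> -` {r})))"

definition elementary_approx ::
  "(nat \<Rightarrow> 'x::topological_space \<Rightarrow> real) \<Rightarrow> ('x \<Rightarrow> ennreal) \<Rightarrow> bool" where
  "elementary_approx \<phi> f \<longleftrightarrow> (\<forall>n. elementary (\<phi> n)) \<and>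
     (\<forall>x. incseq (\<lambda>n. \<phi> n x) \<and> (\<lambda>n. ennreal (\<phi> n x)) \<longlonglongrightarrow> f x)"

text \<open>
  For a measure with values in a monotone complete space the supremum below exists in the extended
  space and does not depend on the approximating sequence, so that the description is proper.
\<close>

definition order_nn_integral ::
  "('x::topological_space set \<Rightarrow> 'e::ordered_real_vector ext) \<Rightarrow> ('x \<Rightarrow> ennreal) \<Rightarrow> 'e ext" where
  "order_nn_integral \<mu> f =
     (THE s. \<exists>\<phi>. elementary_approx \<phi> f \<and> isLub UNIV (range (\<lambda>n. elementary_integral \<mu> (\<phi> n))) s)"

definition order_integrable ::
  "('x::topological_space set \<Rightarrow> 'e::ordered_real_vector ext) \<Rightarrow> ('x \<Rightarrow> real) \<Rightarrow> bool" where
  "order_integrable \<mu> f \<longleftrightarrow> f \<in> borel_measurable borel \<and>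
     order_nn_integral \<mu> (\<lambda>x. ennreal \<bar>f x\<bar>) \<in> range Fin"

definition order_integral ::
  "('x::topological_space set \<Rightarrow> 'e::ordered_real_vector ext) \<Rightarrow> ('x \<Rightarrow> real) \<Rightarrow> 'e" where
  "order_integral \<mu> f =
     the_fin (order_nn_integral \<mu> (\<lambda>x. ennreal (max (f x) 0))) -
     the_fin (order_nn_integral \<mu> (\<lambda>x. ennreal (max (- f x) 0)))"

definition inner_regular_at ::
  "('x::topological_space set \<Rightarrow> 'e::ordered_real_vector ext) \<Rightarrow> 'x set \<Rightarrow> bool" where
  "inner_regular_at \<mu> \<Delta> \<longleftrightarrow> isLub UNIV {\<mu> K |K. compact K \<and> K \<subseteq> \<Delta>} (\<mu> \<Delta>)"

definition outer_regular_at ::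
  "('x::topological_space set \<Rightarrow> 'e::ordered_real_vector ext) \<Rightarrow> 'x set \<Rightarrow> bool" where
  "outer_regular_at \<mu> \<Delta> \<longleftrightarrow> isGlb UNIV {\<mu> V |V. open V \<and> \<Delta> \<subseteq> V} (\<mu> \<Delta>)"

definition regular_borel_measure ::
  "('x::t2_space set \<Rightarrow> 'e::ordered_real_vector ext) \<Rightarrow> bool" where
  "regular_borel_measure \<mu> \<longleftrightarrow> ext_measure \<mu> \<and>
     (\<forall>K. compact K \<longrightarrow> \<mu> K \<in> range Fin) \<and>
     (\<forall>V. open V \<longrightarrow> inner_regular_at \<mu> V) \<and>
     (\<forall>\<Delta>\<in>sets borel. outer_regular_at \<mu> \<Delta>)"


section \<open>Continuous functions with compact support\<close>

definition supp :: "('x::topological_space \<Rightarrow> real) \<Rightarrow> 'x set" where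
  "supp f = closure {x. f x \<noteq> 0}"

definition Cc :: "('x::topological_space \<Rightarrow> real) set" where
  "Cc = {f. continuous_on UNIV f \<and> compact (supp f)}"

definition sup_norm :: "('x \<Rightarrow> real) \<Rightarrow> real" where
  "sup_norm f = (SUP x. \<bar>f x\<bar>)"

definition positive_operator_Cc ::
  "(('x::topological_space \<Rightarrow> real) \<Rightarrow> 'e::ordered_real_vector) \<Rightarrow> bool" where
  "positive_operator_Cc \<pi> \<longleftrightarrow>
     (\<forall>f\<in>Cc. \<forall>g\<in>Cc. \<pi> (\<lambda>x. f x + g x) = \<pi> f + \<pi> g) \<and>
     (\<forall>c. \<forall>f\<in>Cc. \<pi> (\<lambda>x. c * f x) = c *\<^sub>R \<pi> f) \<and>
     (\<forall>f\<in>Cc. (\<forall>x. 0 \<le> f x) \<longrightarrow> 0 \<le> \<pi> f)"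

definition prec_set :: "('x::topological_space \<Rightarrow> real) \<Rightarrow> 'x set \<Rightarrow> bool" where
  "prec_set f S \<longleftrightarrow> f \<in> Cc \<and> (\<forall>x. 0 \<le> f x \<and> f x \<le> 1) \<and> supp f \<subseteq> S"

definition set_prec :: "'x::topological_space set \<Rightarrow> ('x \<Rightarrow> real) \<Rightarrow> bool" where
  "set_prec S f \<longleftrightarrow> f \<in> Cc \<and> (\<forall>x. 0 \<le> f x \<and> f x \<le> 1) \<and> (\<forall>x\<in>S. f x = 1)"

definition represents ::
  "('x::t2_space set \<Rightarrow> 'e::ordered_real_vector ext) \<Rightarrow> (('x \<Rightarrow> real) \<Rightarrow> 'e) \<Rightarrow> bool" where
  "represents \<mu> \<pi> \<longleftrightarrow> (\<forall>f\<in>Cc. order_integrable \<mu> f \<and> \<pi> f = order_integral \<mu> f)"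

end

theory Submission
  imports Defs
begin

text \<open>
  Normality means that the positive order continuous functionals \<open>\<psi>\<close> determine the order of \<open>E\<close>, and
  each of them commutes with monotone suprema and infima. Hence everything reduces to the scalar
  Riesz theorem for \<open>\<psi> \<circ> \<pi>\<close>. The measure is defined in \<open>E\<close> itself, by \<open>\<mu>(V) = \<Squnion>{\<pi>(f) : f \<prec> V}\<close> on
  open sets and by outer approximation on Borel sets; monotone completeness provides these bounds,
  \<open>\<psi> \<circ> \<mu>\<close> is the scalar Riesz measure of \<open>\<psi> \<circ> \<pi>\<close>, and \<open>\<sigma>\<close>-additivity and the integral formula can be
  tested on the functionals. For uniqueness, a function with \<open>K \<prec> f \<prec> V\<close> satisfies
  \<open>\<mu>(K) \<le> \<pi>(f) \<le> \<mu>(V)\<close>, so inner regularity determines \<open>\<mu>\<close> on open sets and outer regularity determines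
  it on Borel sets.
\<close>

section \<open>Suprema and infima\<close>

text \<open>\<open>'e\<close> need not be a lattice, so suprema and infima are available only along
  directed families. This dictates the construction: the functions below an open set are directed by
  pointwise maxima, and the open supersets of a set by intersections. The bound on the unit ball
  bounds the first family above, and \<open>0\<close> bounds the second below, so the constructed
  measure never takes the value \<open>Infty\<close> and every scalar measure in play is finite. A
  competing measure in the uniqueness claim may a priori be infinite on open sets. Its integrals are
  therefore studied after restriction to a set of finite measure, such as the support of the
  integrand. The comparison behind uniqueness also yields finiteness and the formulas on open and
  compact sets, so these hold for every representing measure and are not read off the
  construction.\<close>

lemma isLub_iff:
  fixes s :: "'a::order"
  shows "isLub UNIV S s \<longleftrightarrow> (\<forall>x\<in>S. x \<le> s) \<and> (\<forall>u. (\<forall>x\<in>S. x \<le> u) \<longrightarrow> s \<le> u)"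
  by (auto simp: isLub_def leastP_def isUb_def setle_def setge_def)

lemma isGlb_iff:
  fixes s :: "'a::order"
  shows "isGlb UNIV S s \<longleftrightarrow> (\<forall>x\<in>S. s \<le> x) \<and> (\<forall>u. (\<forall>x\<in>S. u \<le> x) \<longrightarrow> u \<le> s)"
  by (auto simp: isGlb_def greatestP_def isLb_def setle_def setge_def)

lemma isLubI:
  fixes s :: "'a::order"
  assumes "\<And>x. x \<in> S \<Longrightarrow> x \<le> s" "\<And>u. (\<And>x. x \<in> S \<Longrightarrow> x \<le> u) \<Longrightarrow> s \<le> u"
  shows "isLub UNIV S s"
  using assms by (simp add: isLub_iff)

lemma isLub_least: "isLub UNIV S s \<Longrightarrow> (\<And>x. x \<in> S \<Longrightarrow> x \<le> u) \<Longrightarrow> s \<le> u"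
  for s :: "'a::order"
  by (simp add: isLub_iff)

lemma isGlb_greatest: "isGlb UNIV S s \<Longrightarrow> (\<And>x. x \<in> S \<Longrightarrow> u \<le> x) \<Longrightarrow> u \<le> s"
  for s :: "'a::order"
  by (simp add: isGlb_iff)

lemma isLub_unique_order: "isLub UNIV S s \<Longrightarrow> isLub UNIV S t \<Longrightarrow> s = t"
  for s :: "'a::order"
  by (simp add: isLub_iff antisym)

lemma isGlb_unique_order: "isGlb UNIV S s \<Longrightarrow> isGlb UNIV S t \<Longrightarrow> s = t"
  for s :: "'a::order"
  by (simp add: isGlb_iff antisym)

section \<open>Compactly supported functions\<close>

lemma not_in_supp: "x \<notin> supp f \<Longrightarrow> f x = 0"
  unfolding supp_def using closure_subset[of "{x. f x \<noteq> 0}"] by auto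

lemma supp_subset: "closed C \<Longrightarrow> {x. f x \<noteq> 0} \<subseteq> C \<Longrightarrow> supp f \<subseteq> C"
  unfolding supp_def by (rule closure_minimal)

lemma closed_supp: "closed (supp f)"
  by (simp add: supp_def)

lemma CcI:
  fixes f :: "'x::t2_space \<Rightarrow> real"
  assumes "continuous_on UNIV f" "compact C" "{x. f x \<noteq> 0} \<subseteq> C"
  shows "f \<in> Cc"
proof -
  have "C \<inter> supp f = supp f"
    using supp_subset[of C f] compact_imp_closed assms by blast
  then show ?thesis
    using assms(1) compact_Int_closed[OF assms(2) closed_supp[of f]] by (simp add: Cc_def)
qed

lemma Cc_continuous: "f \<in> Cc \<Longrightarrow> continuous_on A f"
  by (auto simp: Cc_def intro: continuous_on_subset)

lemma Cc_compact: "f \<in> Cc \<Longrightarrow> compact (supp f)"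
  by (auto simp: Cc_def)

lemma Cc_measurable: "f \<in> Cc \<Longrightarrow> f \<in> borel_measurable borel"
  by (intro borel_measurable_continuous_onI Cc_continuous)

lemma Cc_zero: "(\<lambda>x. 0) \<in> Cc"
  by (auto simp: Cc_def supp_def)

lemma Cc_add:
  fixes f g :: "'x::t2_space \<Rightarrow> real"
  assumes "f \<in> Cc" "g \<in> Cc" shows "(\<lambda>x. f x + g x) \<in> Cc"
proof (rule CcI)
  show "compact (supp f \<union> supp g)"
    using assms by (simp add: Cc_compact compact_Un)
  show "{x. f x + g x \<noteq> 0} \<subseteq> supp f \<union> supp g"
    by (clarify, rule ccontr, simp add: not_in_supp)
qed (intro continuous_on_add Cc_continuous assms)

lemma Cc_mult:
  fixes f g :: "'x::t2_space \<Rightarrow> real"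
  assumes "f \<in> Cc" "continuous_on UNIV g" shows "(\<lambda>x. f x * g x) \<in> Cc"
proof (rule CcI)
  show "compact (supp f)"
    using assms by (simp add: Cc_compact)
  show "{x. f x * g x \<noteq> 0} \<subseteq> supp f"
    by (clarify, rule ccontr, simp add: not_in_supp)
qed (rule continuous_on_mult[OF Cc_continuous[OF assms(1)] assms(2)])

lemma Cc_cmult: "f \<in> Cc \<Longrightarrow> (\<lambda>x. c * f x) \<in> Cc"
  for f :: "'x::t2_space \<Rightarrow> real"
  using Cc_mult[OF _ continuous_on_const, of f c] by (simp only: mult.commute[of c])

lemma Cc_comp:
  fixes f :: "'x::t2_space \<Rightarrow> real"
  assumes "f \<in> Cc" "continuous_on UNIV h" "h 0 = 0"
  shows "(\<lambda>x. h (f x)) \<in> Cc"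
proof (rule CcI)
  show "continuous_on UNIV (\<lambda>x. h (f x))"
    by (rule continuous_on_compose2[OF assms(2) Cc_continuous[OF assms(1)]]) simp
  show "compact (supp f)"
    using assms by (simp add: Cc_compact)
  show "{x. h (f x) \<noteq> 0} \<subseteq> supp f"
    using assms(3) not_in_supp[of _ f] by (metis (mono_tags, lifting) mem_Collect_eq subsetI)
qed

lemma Cc_bounded:
  fixes f :: "'x::t2_space \<Rightarrow> real"
  assumes "f \<in> Cc" obtains c where "0 < c" "\<And>x. \<bar>f x\<bar> \<le> c"
proof -
  have "bounded (f ` supp f)"
    using assms by (intro compact_imp_bounded compact_continuous_image Cc_continuous Cc_compact)
  then obtain c where "0 < c" "\<forall>y\<in>f ` supp f. norm y \<le> c"
    using bounded_pos by blast
  then have "\<bar>f x\<bar> \<le> c" for x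
    using not_in_supp[of x f] by (cases "x \<in> supp f") auto
  with \<open>0 < c\<close> that show ?thesis by blast
qed

section \<open>Functions subordinate to a set, and Urysohn's lemma\<close>

lemma prec_setI:
  fixes f :: "'x::t2_space \<Rightarrow> real"
  assumes "continuous_on UNIV f" "\<And>x. 0 \<le> f x" "\<And>x. f x \<le> 1"
    "compact C" "{x. f x \<noteq> 0} \<subseteq> C" "C \<subseteq> V"
  shows "prec_set f V"
  using assms CcI[of f C] supp_subset[of C f] compact_imp_closed[of C]
  unfolding prec_set_def by blast

lemma prec_set_zero: "prec_set (\<lambda>x. 0) V"
  by (auto simp: prec_set_def Cc_zero supp_def)

lemma prec_set_emptyD: "prec_set f {} \<Longrightarrow> f = (\<lambda>x. 0)"
  using not_in_supp[of _ f] by (auto simp: prec_set_def)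

lemma prec_set_mono: "prec_set f V \<Longrightarrow> V \<subseteq> W \<Longrightarrow> prec_set f W"
  by (auto simp: prec_set_def)

text \<open>Makes the functions below \<open>V\<close> an upward directed family, so that monotone
  completeness applies to their images.\<close>

lemma prec_set_max:
  fixes f g :: "'x::t2_space \<Rightarrow> real"
  assumes "prec_set f V" "prec_set g V"
  shows "prec_set (\<lambda>x. max (f x) (g x)) V"
proof (rule prec_setI)
  show "compact (supp f \<union> supp g)"
    using assms by (intro compact_Un) (auto simp: prec_set_def Cc_compact)
  show "{x. max (f x) (g x) \<noteq> 0} \<subseteq> supp f \<union> supp g"
    by (clarify, rule ccontr, simp add: not_in_supp)
  show "continuous_on UNIV (\<lambda>x. max (f x) (g x))"
    using assms by (intro continuous_intros) (auto simp: prec_set_def Cc_continuous)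
qed (use assms in \<open>auto simp: prec_set_def le_max_iff_disj\<close>)

lemma prec_set_sup_norm:
  assumes "prec_set f V" shows "sup_norm f \<le> 1"
  unfolding sup_norm_def using assms by (intro cSUP_least) (auto simp: prec_set_def)

lemma sup_norm_le_one:
  fixes f :: "'x::t2_space \<Rightarrow> real"
  assumes "f \<in> Cc" "sup_norm f \<le> 1" shows "f x \<le> 1"
proof -
  obtain c where "\<And>x. \<bar>f x\<bar> \<le> c" using Cc_bounded[OF assms(1)] by blast
  then have "bdd_above (range (\<lambda>x. \<bar>f x\<bar>))" by (rule bdd_aboveI2)
  then have "\<bar>f x\<bar> \<le> sup_norm f"
    unfolding sup_norm_def by (rule cSUP_upper[OF UNIV_I])
  then show ?thesis using assms(2) by linarith
qed

text \<open>Locally compact Hausdorff spaces are completely regular, which provides a separating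
  function but no control of its support. A neighbourhood \<open>U\<close> of \<open>K\<close>
  inside the compact set \<open>L\<close> and a cut at height 1/2 bring the closed support into a
  compact subset of \<open>V\<close>.\<close>

lemma Urysohn_Cc:
  fixes K V :: "'x::t2_space set"
  assumes "locally_compact_space (euclidean :: 'x topology)"
    and "compact K" "open V" "K \<subseteq> V"
  obtains f where "set_prec K f" "prec_set f V"
proof -
  have H: "Hausdorff_space (euclidean :: 'x topology)"
    unfolding Hausdorff_space_def by (simp add: disjnt_def) (metis hausdorff)
  obtain U L where U: "open U" "compact L" "K \<subseteq> U" "U \<subseteq> L"
    using locally_compact_space_compact_closed_compact[of "euclidean :: 'x topology"] H assms(1,2)
    by (metis compactin_euclidean_iff open_openin)
  have "completely_regular_space (euclidean :: 'x topology)"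
    using locally_compact_regular_imp_completely_regular_space assms(1) H by blast
  moreover have "closedin euclidean (- (U \<inter> V))" "compactin euclidean K" "disjnt (-(U \<inter> V)) K"
    using U assms by (auto simp: disjnt_def)
  ultimately obtain f' :: "'x \<Rightarrow> real" where f': "continuous_map euclidean (top_of_set {0..1}) f'"
      "f' ` K \<subseteq> {0}" "f' ` (- (U \<inter> V)) \<subseteq> {1}"
    by (rule Urysohn_completely_regular_closed_compact[of 0 1, OF zero_le_one])
  define f where "f x = 1 - f' x" for x
  have f: "f ` K \<subseteq> {1}" "f ` (- (U \<inter> V)) \<subseteq> {0}"
    using f' by (auto simp: f_def)
  have cont: "continuous_on UNIV f" and le1: "0 \<le> f x" "f x \<le> 1" for x
    using f'(1) by (auto simp: continuous_map_in_subtopology f_def intro!: continuous_intros)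
  \<comment> \<open>The closure of the set where \<open>f\<close> is positive may leave
    \<open>V\<close>. Where \<open>g\<close> is non-zero one has \<open>f x > 1/2\<close>, and the
    condition \<open>1/2 \<le> f x\<close> is closed and still forces \<open>x\<close> into
    \<open>U \<inter> V\<close>.\<close>
  define g where "g x = max 0 (2 * f x - 1)" for x
  define C where "C = L \<inter> {x. 1/2 \<le> f x}"
  have "compact C"
    unfolding C_def using U cont
    by (intro compact_Int_closed closed_Collect_le continuous_intros) auto
  moreover have "{x. g x \<noteq> 0} \<subseteq> C" "C \<subseteq> V"
    using f(2) U(4) by (fastforce simp: g_def C_def)+
  moreover have "continuous_on UNIV g"
    unfolding g_def using cont by (intro continuous_intros)
  moreover have "0 \<le> g x" "g x \<le> 1" for x
    using le1[of x] by (auto simp: g_def)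
  ultimately have "prec_set g V"
    using prec_setI[of g C V] by blast
  moreover from this have "set_prec K g"
    using f(1) by (force simp: set_prec_def prec_set_def g_def)
  ultimately show ?thesis using that by blast
qed

lemma Cc_sum:
  fixes f :: "'i \<Rightarrow> 'x::t2_space \<Rightarrow> real"
  assumes "\<And>i. i \<in> I \<Longrightarrow> f i \<in> Cc"
  shows "(\<lambda>x. \<Sum>i\<in>I. f i x) \<in> Cc"
  using assms by (induction I rule: infinite_finite_induct) (auto simp: Cc_zero intro!: Cc_add)

section \<open>Linearity and monotonicity of positive operators\<close>

context
  fixes \<pi> :: "('x::t2_space \<Rightarrow> real) \<Rightarrow> 'e::ordered_real_vector"
  assumes pos: "positive_operator_Cc \<pi>"
begin

lemma positive_operator_add: "f \<in> Cc \<Longrightarrow> g \<in> Cc \<Longrightarrow> \<pi> (\<lambda>x. f x + g x) = \<pi> f + \<pi> g"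
  and positive_operator_scale: "f \<in> Cc \<Longrightarrow> \<pi> (\<lambda>x. c * f x) = c *\<^sub>R \<pi> f"
  and positive_operator_nonneg: "f \<in> Cc \<Longrightarrow> (\<And>x. 0 \<le> f x) \<Longrightarrow> 0 \<le> \<pi> f"
  using pos by (auto simp: positive_operator_Cc_def)

lemma positive_operator_zero: "\<pi> (\<lambda>x. 0) = 0"
  using positive_operator_scale[OF Cc_zero, of 0] by simp

lemma positive_operator_diff:
  assumes "f \<in> Cc" "g \<in> Cc" shows "\<pi> (\<lambda>x. f x - g x) = \<pi> f - \<pi> g"
  using positive_operator_add[OF assms(1) Cc_cmult[OF assms(2), of "-1"]]
    positive_operator_scale[OF assms(2), of "-1"] by simp

lemma positive_operator_mono:
  assumes "f \<in> Cc" "g \<in> Cc" "\<And>x. f x \<le> g x" shows "\<pi> f \<le> \<pi> g"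
  using positive_operator_nonneg[OF Cc_add[OF assms(2) Cc_cmult[OF assms(1), of "-1"]]]
    positive_operator_diff[OF assms(2,1)] assms(3) by simp

lemma positive_operator_sum:
  assumes "\<And>i. i \<in> I \<Longrightarrow> f i \<in> Cc"
  shows "\<pi> (\<lambda>x. \<Sum>i\<in>I. f i x) = (\<Sum>i\<in>I. \<pi> (f i))"
  using assms
  by (induction I rule: infinite_finite_induct)
    (auto simp: positive_operator_zero positive_operator_add Cc_sum)

end

section \<open>The scalar Riesz representation theorem\<close>

locale positive_Cc_functional =
  fixes L :: "('x::t2_space \<Rightarrow> real) \<Rightarrow> real"
  assumes lc: "locally_compact_space (euclidean :: 'x topology)"
    and pos: "positive_operator_Cc L"
begin

definition open_content :: "'x set \<Rightarrow> ennreal" where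
  "open_content V = (SUP f\<in>{f. prec_set f V}. ennreal (L f))"

definition outer_content :: "'x set \<Rightarrow> ennreal" where
  "outer_content A = (INF V\<in>{V. open V \<and> A \<subseteq> V}. open_content V)"

lemma nonneg: "prec_set f V \<Longrightarrow> 0 \<le> L f"
  using positive_operator_nonneg[OF pos] by (auto simp: prec_set_def)

lemma le_open_content: "prec_set f V \<Longrightarrow> ennreal (L f) \<le> open_content V"
  unfolding open_content_def by (rule SUP_upper) simp

lemma open_content_le: "(\<And>f. prec_set f V \<Longrightarrow> ennreal (L f) \<le> c) \<Longrightarrow> open_content V \<le> c"
  unfolding open_content_def by (rule SUP_least) simp

lemma open_content_mono: "V \<subseteq> W \<Longrightarrow> open_content V \<le> open_content W"
  using prec_set_mono by (blast intro: open_content_le le_open_content)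

lemma outer_content_le: "open V \<Longrightarrow> A \<subseteq> V \<Longrightarrow> outer_content A \<le> open_content V"
  unfolding outer_content_def by (rule INF_lower) simp

lemma outer_content_open: "open V \<Longrightarrow> outer_content V = open_content V"
  by (rule antisym[OF outer_content_le])
    (auto simp: outer_content_def intro!: INF_greatest open_content_mono)

lemma outer_content_mono: "A \<subseteq> B \<Longrightarrow> outer_content A \<le> outer_content B"
  unfolding outer_content_def by (rule INF_superset_mono) auto

lemma open_content_empty: "open_content {} = 0"
proof -
  have "L f = 0" if "prec_set f {}" for f
    using prec_set_emptyD[OF that] positive_operator_zero[OF pos] by simp
  then have "open_content {} \<le> 0"
    by (intro open_content_le) simp
  then show ?thesis by simp
qed

text \<open>A partition of unity for two sets: a cutoff \<open>v\<close>, equal to 1 near the part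
  of \<open>supp f\<close> that \<open>W\<close> misses, splits \<open>f\<close> into
  \<open>f * v\<close> and \<open>f * (1 - v)\<close>.\<close>

lemma prec_set_Un_split:
  fixes V W :: "'x set"
  assumes "prec_set f (V \<union> W)" "open V" "open W"
  obtains g h where "prec_set g V" "prec_set h W" "f = (\<lambda>x. g x + h x)"
proof -
  have f: "f \<in> Cc" "0 \<le> f x" "f x \<le> 1" "supp f \<subseteq> V \<union> W" for x
    using assms(1) by (auto simp: prec_set_def)
  have "compact (supp f - W)"
    using compact_Int_closed[OF Cc_compact[OF f(1)], of "-W"] assms(3)
    by (simp add: Diff_eq closed_Compl)
  moreover have "supp f - W \<subseteq> V" using f(4) by blast
  ultimately obtain u where u: "set_prec (supp f - W) u" "prec_set u V"
    by (rule Urysohn_Cc[OF lc _ assms(2)])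
  have contu: "continuous_on UNIV u" and u01: "0 \<le> u x" "u x \<le> 1" for x
    using u by (auto simp: prec_set_def Cc_continuous)
  \<comment> \<open>\<open>v = 1\<close> on a neighbourhood of \<open>supp f - W\<close>, so that the support of \<open>f (1 - v)\<close> stays in \<open>W\<close>.\<close>
  define v where "v x = min 1 (2 * u x)" for x
  have v: "continuous_on UNIV v" "0 \<le> v x" "v x \<le> 1" "u x = 0 \<Longrightarrow> v x = 0"
      "1/2 \<le> u x \<Longrightarrow> v x = 1" for x
    using u01[of x] contu by (auto simp: v_def intro!: continuous_intros)
  have "prec_set (\<lambda>x. f x * v x) V"
  proof (rule prec_setI)
    show "continuous_on UNIV (\<lambda>x. f x * v x)"
      by (intro continuous_on_mult v(1) Cc_continuous[OF f(1)])
    show "compact (supp u)" "supp u \<subseteq> V"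
      using u(2) by (auto simp: prec_set_def Cc_compact)
    show "{x. f x * v x \<noteq> 0} \<subseteq> supp u"
      using not_in_supp[of _ u] v(4) by (metis (mono_tags, lifting) mem_Collect_eq mult_eq_0_iff subsetI)
    show "0 \<le> f x * v x" "f x * v x \<le> 1" for x
      using f v by (auto intro: mult_le_one)
  qed
  moreover have "prec_set (\<lambda>x. f x * (1 - v x)) W"
  proof (rule prec_setI)
    show "continuous_on UNIV (\<lambda>x. f x * (1 - v x))"
      by (intro continuous_on_mult continuous_on_diff continuous_on_const v(1) Cc_continuous[OF f(1)])
    \<comment> \<open>On \<open>supp f - W\<close> the function \<open>u\<close> equals 1, so the
      bound \<open>u x \<le> 1/2\<close> excludes these points and leaves a compact subset of
      \<open>W\<close>.\<close>
    let ?C = "supp f \<inter> {x. u x \<le> 1/2}"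
    show "compact ?C"
      using contu f(1)
      by (intro compact_Int_closed Cc_compact closed_Collect_le continuous_on_const) auto
    show "?C \<subseteq> W"
    proof (clarify, rule ccontr)
      fix x assume "x \<in> supp f" "u x \<le> 1/2" "x \<notin> W"
      then show False using u(1) by (auto simp: set_prec_def)
    qed
    show "{x. f x * (1 - v x) \<noteq> 0} \<subseteq> ?C"
    proof clarify
      fix x assume "f x * (1 - v x) \<noteq> 0"
      then show "x \<in> supp f \<inter> {x. u x \<le> 1/2}"
        using not_in_supp[of x f] v(5)[of x] by fastforce
    qed
    show "0 \<le> f x * (1 - v x)" "f x * (1 - v x) \<le> 1" for x
      using f v by (auto intro: mult_le_one)
  qed
  ultimately show ?thesis
    by (rule that) (simp add: algebra_simps)
qed

lemma open_content_Un:
  assumes "open V" "open W"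
  shows "open_content (V \<union> W) \<le> open_content V + open_content W"
proof (rule open_content_le)
  fix f assume "prec_set f (V \<union> W)"
  then obtain g h where gh: "prec_set g V" "prec_set h W" "f = (\<lambda>x. g x + h x)"
    using prec_set_Un_split assms by blast
  then have "L f = L g + L h"
    using positive_operator_add[OF pos] by (simp add: prec_set_def)
  then have "ennreal (L f) = ennreal (L g) + ennreal (L h)"
    using gh nonneg by (metis ennreal_plus)
  then show "ennreal (L f) \<le> open_content V + open_content W"
    using gh le_open_content by (metis add_mono)
qed

text \<open>Compactness of \<open>supp f\<close> reduces the countable union to a finite one, where
  binary subadditivity can be iterated.\<close>

lemma open_content_UN_le:
  assumes "\<And>i::nat. open (V i)"
  shows "open_content (\<Union>i. V i) \<le> (\<Sum>i. open_content (V i))"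
proof (rule open_content_le)
  fix f assume f: "prec_set f (\<Union>i. V i)"
  then have "compact (supp f)" "supp f \<subseteq> (\<Union>i\<in>UNIV. V i)"
    by (auto simp: prec_set_def Cc_compact)
  then obtain I where I: "finite I" "supp f \<subseteq> (\<Union>i\<in>I. V i)"
    using assms compactE_image[of "supp f" UNIV V] by metis
  have "open_content (\<Union>i\<in>I. V i) \<le> (\<Sum>i\<in>I. open_content (V i))"
    using I(1)
  proof (induction I)
    case (insert i I)
    have "open_content (V i \<union> (\<Union>i\<in>I. V i)) \<le> open_content (V i) + open_content (\<Union>i\<in>I. V i)"
      using assms by (intro open_content_Un) auto
    with insert show ?case
      by (auto intro: order_trans add_left_mono)
  qed (simp add: open_content_empty)
  also have "\<dots> \<le> (\<Sum>i. open_content (V i))"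
    using I(1) by (intro sum_le_suminf) auto
  finally show "ennreal (L f) \<le> (\<Sum>i. open_content (V i))"
    using le_open_content[of f "\<Union>i\<in>I. V i"] f I(2) by (simp add: prec_set_def)
qed

text \<open>Each set is enclosed in an open set with error \<open>e * (1/2) ^ Suc i\<close>; these
  weights add up to \<open>e\<close>.\<close>

lemma outer_content_UN_le: "outer_content (\<Union>i::nat. A i) \<le> (\<Sum>i. outer_content (A i))"
proof (rule ennreal_le_epsilon)
  fix e :: real
  assume "0 < e" and fin: "(\<Sum>i. outer_content (A i)) < top"
  have "\<exists>V. open V \<and> A i \<subseteq> V \<and> open_content V \<le> outer_content (A i) + ennreal (e * (1/2) ^ Suc i)" for i
  proof -
    have "outer_content (A i) < top"
      using fin ennreal_suminf_lessD by blast
    then have "outer_content (A i) < outer_content (A i) + ennreal (e * (1/2) ^ Suc i)"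
      using \<open>0 < e\<close> by (cases "outer_content (A i)") (auto simp flip: ennreal_plus intro!: ennreal_lessI add_nonneg_pos)
    then show ?thesis
      unfolding outer_content_def[of "A i"] INF_less_iff by (auto intro: less_imp_le)
  qed
  then obtain V where V: "\<And>i. open (V i)" "\<And>i. A i \<subseteq> V i"
      "\<And>i. open_content (V i) \<le> outer_content (A i) + ennreal (e * (1/2) ^ Suc i)"
    by metis
  have "outer_content (\<Union>i. A i) \<le> open_content (\<Union>i. V i)"
    using V by (intro outer_content_le) auto
  also have "\<dots> \<le> (\<Sum>i. open_content (V i))"
    using V by (intro open_content_UN_le)
  also have "\<dots> \<le> (\<Sum>i. outer_content (A i) + ennreal (e * (1/2) ^ Suc i))"
    using V by (intro suminf_le) auto
  also have "\<dots> = (\<Sum>i. outer_content (A i)) + (\<Sum>i. ennreal (e * (1/2) ^ Suc i))"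
    by (subst suminf_add) auto
  also have "(\<Sum>i. ennreal (e * (1/2) ^ Suc i)) = ennreal e"
    using sums_mult[OF power_half_series, of e] \<open>0 < e\<close>
    by (intro suminf_ennreal_eq) auto
  finally show "outer_content (\<Union>i. A i) \<le> (\<Sum>i. outer_content (A i)) + ennreal e" .
qed

text \<open>This is the hard half of Caratheodory's condition for \<open>V\<close>, tested on an
  open set \<open>W\<close>. If \<open>f\<close> lies below \<open>W \<inter> V\<close> and
  \<open>g\<close> below \<open>W - supp f\<close>, the supports are disjoint, so
  \<open>f + g\<close> is still bounded by 1 and lies below \<open>W\<close>. The supremum is taken
  over \<open>g\<close> and afterwards over \<open>f\<close>.\<close>

lemma open_content_superadditive:
  assumes "open V" "open W"
  shows "outer_content (W \<inter> V) + outer_content (W - V) \<le> open_content W"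
proof -
  have *: "ennreal (L f) + outer_content (W - V) \<le> open_content W" if f: "prec_set f (W \<inter> V)" for f
  proof -
    have "outer_content (W - V) \<le> open_content (W - supp f)"
      using f assms closed_supp[of f] by (intro outer_content_le open_Diff) (auto simp: prec_set_def)
    \<comment> \<open>A constant may be moved inside a supremum only over a non-empty index set; the
      zero function is a member.\<close>
    also have "ennreal (L f) + \<dots> = (SUP g\<in>{g. prec_set g (W - supp f)}. ennreal (L f) + ennreal (L g))"
      unfolding open_content_def
      using prec_set_zero by (subst ennreal_SUP_add_right) auto
    also have "\<dots> \<le> open_content W"
    proof (rule SUP_least, clarify)
      fix g assume g: "prec_set g (W - supp f)"
      have "prec_set (\<lambda>x. f x + g x) W"
      proof (rule prec_setI)
        show "continuous_on UNIV (\<lambda>x. f x + g x)"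
          using f g by (intro continuous_on_add) (auto simp: prec_set_def Cc_continuous)
        show "compact (supp f \<union> supp g)" "supp f \<union> supp g \<subseteq> W"
          using f g by (auto simp: prec_set_def intro!: compact_Un Cc_compact)
        show "{x. f x + g x \<noteq> 0} \<subseteq> supp f \<union> supp g"
          by (clarify, rule ccontr, simp add: not_in_supp)
        fix x
        show "0 \<le> f x + g x"
          using f g by (auto simp: prec_set_def)
        show "f x + g x \<le> 1"
        proof (cases "x \<in> supp f")
          case True
          then have "x \<notin> supp g" using g by (auto simp: prec_set_def)
          then show ?thesis using f not_in_supp[of x g] by (auto simp: prec_set_def)
        next
          case False
          then show ?thesis using g not_in_supp[of x f] by (auto simp: prec_set_def)
        qed
      qed
      then have "ennreal (L (\<lambda>x. f x + g x)) \<le> open_content W"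
        by (rule le_open_content)
      then show "ennreal (L f) + ennreal (L g) \<le> open_content W"
        using f g positive_operator_add[OF pos, of f g] nonneg[OF f] nonneg[OF g]
        by (simp add: prec_set_def ennreal_plus)
    qed
    finally show ?thesis by (simp add: add_left_mono)
  qed
  have "outer_content (W \<inter> V) + outer_content (W - V)
      = (SUP f\<in>{f. prec_set f (W \<inter> V)}. ennreal (L f) + outer_content (W - V))"
    unfolding outer_content_open[OF open_Int[OF assms(2,1)]] open_content_def
    using prec_set_zero by (subst ennreal_SUP_add_left) auto
  also have "\<dots> \<le> open_content W"
    using * by (auto intro: SUP_least)
  finally show ?thesis .
qed

lemma outer_measure_space: "outer_measure_space UNIV outer_content"
  unfolding outer_measure_space_def
proof (intro conjI)
  show "positive UNIV outer_content"
    by (simp add: positive_def outer_content_open open_content_empty)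
  show "increasing UNIV outer_content"
    by (auto simp: increasing_def intro: outer_content_mono)
  show "countably_subadditive UNIV outer_content"
    by (auto simp: countably_subadditive_def intro: outer_content_UN_le)
qed

section \<open>Caratheodory restriction to the Borel sets\<close>

interpretation Pow: sigma_algebra "UNIV :: 'x set" UNIV
  using sigma_algebra_Pow[of "UNIV :: 'x set"] by simp

text \<open>For arbitrary \<open>A\<close> the hard inequality follows from the one for open
  \<open>W\<close> containing \<open>A\<close>, by monotonicity and an infimum over
  \<open>W\<close>. The opposite inequality is subadditivity.\<close>

lemma open_in_lambda_system:
  assumes "open V" shows "V \<in> lambda_system UNIV UNIV outer_content"
  unfolding Pow.lambda_system_eq
proof (intro CollectI conjI ballI antisym)
  fix A
  show "outer_content (A \<inter> V) + outer_content (A - V) \<le> outer_content A"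
    unfolding outer_content_def[of A]
  proof (rule INF_greatest, clarify)
    fix W assume W: "open W" "A \<subseteq> W"
    have "outer_content (A \<inter> V) + outer_content (A - V)
        \<le> outer_content (W \<inter> V) + outer_content (W - V)"
      using W by (intro add_mono outer_content_mono) auto
    also have "\<dots> \<le> open_content W"
      using assms W by (intro open_content_superadditive)
    finally show "outer_content (A \<inter> V) + outer_content (A - V) \<le> open_content W" .
  qed
  have "subadditive UNIV outer_content"
    using outer_measure_space Pow.countably_subadditive_subadditive
    by (auto simp: outer_measure_space_def)
  moreover have "(A \<inter> V) \<inter> (A - V) = {}" by blast
  ultimately have "outer_content ((A \<inter> V) \<union> (A - V)) \<le> outer_content (A \<inter> V) + outer_content (A - V)"
    by (auto simp: subadditive_def)
  then show "outer_content A \<le> outer_content (A \<inter> V) + outer_content (A - V)"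
    by (simp add: Int_Diff_Un)
qed simp

lemma measure_space_outer_content: "measure_space UNIV (sets borel) outer_content"
proof -
  have ms: "measure_space UNIV (lambda_system UNIV UNIV outer_content) outer_content"
    by (rule Pow.caratheodory_lemma[OF outer_measure_space])
  then have "sigma_sets UNIV {S. open S} \<subseteq> lambda_system UNIV UNIV outer_content"
    using open_in_lambda_system
    by (intro sigma_algebra.sigma_sets_subset) (auto simp: measure_space_def)
  then have "sets borel \<subseteq> lambda_system UNIV UNIV outer_content"
    by (simp add: borel_def)
  with ms show ?thesis
    using measure_down sets.sigma_algebra_axioms[of borel] by (simp add: space_borel) blast
qed

definition riesz_measure :: "'x measure" where
  "riesz_measure = measure_of UNIV (sets borel) outer_content"

lemma sets_riesz_measure [measurable_cong, simp]: "sets riesz_measure = sets borel"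
  and space_riesz_measure [simp]: "space riesz_measure = UNIV"
  using sets.sets_measure_of_eq[of borel] by (simp_all add: riesz_measure_def)

lemma emeasure_riesz_measure:
  "A \<in> sets borel \<Longrightarrow> emeasure riesz_measure A = outer_content A"
  unfolding riesz_measure_def using measure_space_outer_content
  by (intro emeasure_measure_of_sigma) (auto simp: measure_space_def)

lemma emeasure_riesz_measure_open: "open V \<Longrightarrow> emeasure riesz_measure V = open_content V"
  by (simp add: emeasure_riesz_measure outer_content_open)

end

section \<open>Integral representation of bounded scalar functionals\<close>

text \<open>The summand with index \<open>i\<close> is the part of the height \<open>y\<close> lying
  between \<open>i\<close> and \<open>i + 1\<close>. Applied to \<open>y = n * f x\<close>, this
  cuts a function into \<open>n\<close> layers.\<close>

lemma sum_truncations: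
  "0 \<le> y \<Longrightarrow> (\<Sum>i<n. min 1 (max 0 (y - real i))) = min (real n) y"
  by (induction n) (auto simp: min_def max_def)

text \<open>The step two arises because the layer with index \<open>i\<close> is squeezed between
  quantities with indices \<open>i + 2\<close> and \<open>i\<close>; the accumulated error then
  consists of boundary terms only.\<close>

lemma sum_telescope_two:
  "(\<Sum>i<n. b i - b (i + 2)) = b 0 + b 1 - b n - b (n + 1)" for b :: "nat \<Rightarrow> real"
  by (induction n) auto

locale bounded_positive_Cc_functional = positive_Cc_functional +
  fixes c :: real
  assumes bounded: "prec_set f UNIV \<Longrightarrow> L f \<le> c"
begin

lemma open_content_finite: "open_content V \<le> ennreal c"
  using bounded prec_set_mono[of _ V UNIV]
  by (intro open_content_le ennreal_leI) auto

sublocale finite_measure riesz_measure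
proof
  show "emeasure riesz_measure (space riesz_measure) \<noteq> \<infinity>"
    using open_content_finite[of UNIV]
    by (auto simp: emeasure_riesz_measure_open top_unique)
qed

lemma integrable_Cc: "f \<in> Cc \<Longrightarrow> integrable riesz_measure f"
  by (rule Cc_bounded[of f], assumption, rule integrable_const_bound)
    (use Cc_measurable in \<open>auto simp: measurable_def\<close>)

text \<open>Every \<open>f\<close> below \<open>V\<close> is dominated by \<open>g\<close>: on
  \<open>V\<close> because \<open>f \<le> 1 \<le> g\<close>, elsewhere because \<open>f\<close>
  vanishes.\<close>

lemma measure_open_le:
  assumes "open V" "g \<in> Cc" "\<And>x. 0 \<le> g x" "\<And>x. x \<in> V \<Longrightarrow> 1 \<le> g x"
  shows "measure riesz_measure V \<le> L g"
proof -
  have "L f \<le> L g" if f: "prec_set f V" for f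
  proof (rule positive_operator_mono[OF pos])
    show "f x \<le> g x" for x
    proof (cases "x \<in> supp f")
      case True
      then have "x \<in> V" "f x \<le> 1" using f by (auto simp: prec_set_def)
      then show ?thesis using assms(4)[of x] by linarith
    next
      case False
      then show ?thesis using assms(3)[of x] not_in_supp[of x f] by simp
    qed
  qed (use f assms in \<open>auto simp: prec_set_def\<close>)
  then have "emeasure riesz_measure V \<le> ennreal (L g)"
    using assms(1) by (auto simp: emeasure_riesz_measure_open intro!: open_content_le ennreal_leI)
  then show ?thesis
    using positive_operator_nonneg[OF pos] assms(2,3) by (simp add: emeasure_eq_measure)
qed

lemma le_measure_open:
  assumes "open V" "prec_set g V"
  shows "L g \<le> measure riesz_measure V"
  using le_open_content[OF assms(2)] assms(1) nonneg[OF assms(2)]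
  by (simp add: emeasure_riesz_measure_open[symmetric] emeasure_eq_measure)

text \<open>Cut \<open>n * f\<close> into \<open>n\<close> layers \<open>g i\<close> with values in
  \<open>[0,1]\<close>. Each layer equals 1 on \<open>W (i + 2)\<close> and is supported in
  \<open>W i\<close>, so \<open>L (g i)\<close> and the integral of \<open>g i\<close> lie between
  the same two measures. The errors telescope to at most twice the total mass, whatever
  \<open>n\<close> is, so dividing by \<open>n\<close> leaves no room for a difference.\<close>

lemma representation_unit:
  assumes f: "f \<in> Cc" "\<And>x. 0 \<le> f x" "\<And>x. f x \<le> 1"
  shows "L f = (\<integral>x. f x \<partial>riesz_measure)"
proof -
  have bound: "real n * \<bar>L f - (\<integral>x. f x \<partial>riesz_measure)\<bar> \<le> 2 * measure riesz_measure UNIV"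
    for n
  proof -
    define h where "h i y = min 1 (max 0 (real n * y - real i))" for i :: nat and y
    define g where "g i x = h i (f x)" for i x
    \<comment> \<open>The shift by one makes \<open>W i\<close> an open set containing the closed
      set \<open>{x. real i \<le> real n * f x}\<close>, and with it the closed support of
      \<open>g i\<close>.\<close>
    define W where "W i = {x. real i - 1 < real n * f x}" for i :: nat
    define b where "b i = measure riesz_measure (W i)" for i
    have openW: "open (W i)" for i
      unfolding W_def using f(1)
      by (intro open_Collect_less continuous_on_const continuous_on_mult Cc_continuous)
    have g: "g i \<in> Cc" for i
      unfolding g_def using f(1) by (rule Cc_comp) (auto simp: h_def intro!: continuous_intros)
    have g01: "0 \<le> g i x" "g i x \<le> 1" for i x
      by (auto simp: g_def h_def)
    have gW: "1 \<le> g i x" if "x \<in> W (i + 2)" for i x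
      using that by (auto simp: g_def h_def W_def)
    have suppg: "supp (g i) \<subseteq> W i" for i
    proof -
      have "supp (g i) \<subseteq> {x. real i \<le> real n * f x}"
        using f(1) by (intro supp_subset closed_Collect_le continuous_on_const continuous_on_mult Cc_continuous)
          (auto simp: g_def h_def)
      then show ?thesis by (auto simp: W_def)
    qed
    have L: "b (i + 2) \<le> L (g i)" "L (g i) \<le> b i" for i
    proof -
      show "b (i + 2) \<le> L (g i)"
        unfolding b_def using openW g g01 gW by (intro measure_open_le) auto
      show "L (g i) \<le> b i"
        unfolding b_def using openW g g01 suppg by (intro le_measure_open) (auto simp: prec_set_def)
    qed
    have I: "b (i + 2) \<le> (\<integral>x. g i x \<partial>riesz_measure)" "(\<integral>x. g i x \<partial>riesz_measure) \<le> b i" for i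
    proof -
      have b: "b j = (\<integral>x. indicator (W j) x \<partial>riesz_measure)"
        "integrable riesz_measure (indicator (W j) :: 'a \<Rightarrow> real)" for j
        using openW by (auto simp: b_def emeasure_eq_measure)
      show "b (i + 2) \<le> (\<integral>x. g i x \<partial>riesz_measure)"
        unfolding b(1) using b(2) integrable_Cc[OF g] g01 gW
        by (intro integral_mono) (auto simp: indicator_def)
      show "(\<integral>x. g i x \<partial>riesz_measure) \<le> b i"
        unfolding b(1)
      proof (rule integral_mono[OF integrable_Cc[OF g] b(2)])
        fix x
        show "g i x \<le> indicator (W i) x"
          using g01[of i x] suppg[of i] not_in_supp[of x "g i"] by (cases "x \<in> W i") auto
      qed
    qed
    \<comment> \<open>Here \<open>f x \<le> 1\<close> enters: the \<open>n\<close> layers reach up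
      to height \<open>n\<close>, so nothing of \<open>n * f x\<close> is cut off.\<close>
    have sum: "(\<Sum>i<n. g i x) = real n * f x" for x
      using f(2,3)[of x] sum_truncations[of "real n * f x" n]
      by (simp add: g_def h_def mult_left_le)
    have "real n * L f = (\<Sum>i<n. L (g i))"
      using positive_operator_sum[OF pos, of "{..<n}" g] g positive_operator_scale[OF pos f(1), of "real n"]
      by (simp add: sum)
    moreover have "real n * (\<integral>x. f x \<partial>riesz_measure) = (\<Sum>i<n. \<integral>x. g i x \<partial>riesz_measure)"
      using Bochner_Integration.integral_sum[of "{..<n}" riesz_measure g] integrable_Cc[OF g]
      by (simp add: sum)
    moreover have "\<bar>(\<Sum>i<n. L (g i)) - (\<Sum>i<n. \<integral>x. g i x \<partial>riesz_measure)\<bar> \<le> (\<Sum>i<n. b i - b (i + 2))"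
    proof -
      have "\<bar>L (g i) - (\<integral>x. g i x \<partial>riesz_measure)\<bar> \<le> b i - b (i + 2)" for i
        using L[of i] I[of i] by linarith
      then show ?thesis
        unfolding sum_subtractf[symmetric] by (intro order_trans[OF sum_abs] sum_mono)
    qed
    moreover have "(\<Sum>i<n. b i - b (i + 2)) \<le> 2 * measure riesz_measure UNIV"
    proof -
      have "0 \<le> b i" "b i \<le> measure riesz_measure UNIV" for i
        using bounded_measure[of "W i"] by (auto simp: b_def)
      note this[of 0] this[of 1] this[of n] this[of "n + 1"]
      then show ?thesis unfolding sum_telescope_two by linarith
    qed
    ultimately have "\<bar>real n * (L f - (\<integral>x. f x \<partial>riesz_measure))\<bar> \<le> 2 * measure riesz_measure UNIV"
      unfolding right_diff_distrib by linarith
    then show ?thesis by (simp add: abs_mult)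
  qed
  show ?thesis
  proof (rule ccontr)
    assume "L f \<noteq> (\<integral>x. f x \<partial>riesz_measure)"
    then have "0 < \<bar>L f - (\<integral>x. f x \<partial>riesz_measure)\<bar>" by simp
    then obtain n :: nat where "2 * measure riesz_measure UNIV < real n * \<bar>L f - (\<integral>x. f x \<partial>riesz_measure)\<bar>"
      using reals_Archimedean3 by blast
    with bound[of n] show False by linarith
  qed
qed

lemma representation_nonneg:
  assumes f: "f \<in> Cc" "\<And>x. 0 \<le> f x"
  shows "L f = (\<integral>x. f x \<partial>riesz_measure)"
proof -
  obtain d where d: "0 < d" "\<And>x. \<bar>f x\<bar> \<le> d"
    using Cc_bounded[OF f(1)] by blast
  have "L (\<lambda>x. (1 / d) * f x) = (\<integral>x. (1 / d) * f x \<partial>riesz_measure)"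
    using d f(2) by (intro representation_unit Cc_cmult f(1)) (auto simp: abs_le_iff)
  then show ?thesis
    using d(1) positive_operator_scale[OF pos f(1), of "1 / d"] by simp
qed

lemma representation:
  assumes f: "f \<in> Cc"
  shows "L f = (\<integral>x. f x \<partial>riesz_measure)"
proof -
  have pn: "(\<lambda>x. max (f x) 0) \<in> Cc" "(\<lambda>x. max (- f x) 0) \<in> Cc"
    using f by (rule Cc_comp; auto intro!: continuous_intros)+
  have "f = (\<lambda>x. max (f x) 0 - max (- f x) 0)" by auto
  then have "L f = L (\<lambda>x. max (f x) 0) - L (\<lambda>x. max (- f x) 0)"
    using positive_operator_diff[OF pos pn] by simp
  also have "\<dots> = (\<integral>x. max (f x) 0 \<partial>riesz_measure) - (\<integral>x. max (- f x) 0 \<partial>riesz_measure)"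
    using pn by (simp add: representation_nonneg)
  also have "\<dots> = (\<integral>x. max (f x) 0 - max (- f x) 0 \<partial>riesz_measure)"
    using pn by (intro Bochner_Integration.integral_diff[symmetric] integrable_Cc)
  also have "\<dots> = (\<integral>x. f x \<partial>riesz_measure)"
    by (intro Bochner_Integration.integral_cong) auto
  finally show ?thesis .
qed

end

section \<open>Order continuous functionals on normal spaces\<close>

definition oc_functional :: "('e::ordered_real_vector \<Rightarrow> real) \<Rightarrow> bool" where
  "oc_functional \<psi> \<longleftrightarrow> positive_functional \<psi> \<and> order_continuous \<psi>"

lemma oc_functional_linear: "oc_functional \<psi> \<Longrightarrow> linear \<psi>"
  by (simp add: oc_functional_def positive_functional_def)

lemma oc_functional_nonneg: "oc_functional \<psi> \<Longrightarrow> 0 \<le> x \<Longrightarrow> 0 \<le> \<psi> x"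
  by (simp add: oc_functional_def positive_functional_def)

lemma oc_functional_mono:
  assumes "oc_functional \<psi>" "x \<le> y" shows "\<psi> x \<le> \<psi> y"
  using oc_functional_nonneg[OF assms(1), of "y - x"] assms
  by (simp add: linear_diff[OF oc_functional_linear])

lemma normal_le_iff:
  fixes x y :: "'e::ordered_real_vector"
  assumes "normal_space_order TYPE('e)"
  shows "x \<le> y \<longleftrightarrow> (\<forall>\<psi>. oc_functional \<psi> \<longrightarrow> \<psi> x \<le> \<psi> y)"
proof -
  have "x \<le> y \<longleftrightarrow> 0 \<le> y - x" by simp
  also have "\<dots> \<longleftrightarrow> (\<forall>\<psi>. oc_functional \<psi> \<longrightarrow> 0 \<le> \<psi> (y - x))"
    using assms unfolding normal_space_order_def oc_functional_def by metis
  also have "\<dots> \<longleftrightarrow> (\<forall>\<psi>. oc_functional \<psi> \<longrightarrow> \<psi> x \<le> \<psi> y)"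
    using linear_diff[OF oc_functional_linear] by (metis diff_ge_0_iff_ge)
  finally show ?thesis .
qed

lemma normal_eqI:
  fixes x y :: "'e::ordered_real_vector"
  assumes "normal_space_order TYPE('e)" "\<And>\<psi>. oc_functional \<psi> \<Longrightarrow> \<psi> x = \<psi> y"
  shows "x = y"
  using assms by (metis antisym order_refl normal_le_iff)

text \<open>Order continuity speaks only of nets decreasing to 0. Translating by \<open>s\<close>
  reduces to that case, and linearity of \<open>\<psi>\<close> translates back.\<close>

lemma oc_functional_isGlb:
  assumes "oc_functional \<psi>" "decreasing_net I r x" "isGlb UNIV (x ` I) s"
  shows "isGlb UNIV ((\<lambda>i. \<psi> (x i)) ` I) (\<psi> s)"
proof -
  have "isGlb UNIV ((\<lambda>i. x i - s) ` I) 0"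
  proof -
    have "u \<le> 0" if "\<forall>i\<in>I. u \<le> x i - s" for u
    proof -
      have "\<forall>i\<in>I. u + s \<le> x i" using that by (simp add: le_diff_eq)
      then have "u + s \<le> s" using assms(3) by (auto simp: isGlb_iff)
      then show ?thesis by simp
    qed
    then show ?thesis using assms(3) by (auto simp: isGlb_iff)
  qed
  then have "decreases_to I r (\<lambda>i. x i - s) 0"
    using assms(2) by (simp add: decreases_to_def decreasing_net_def)
  then have "isGlb UNIV ((\<lambda>i. \<psi> (x i - s)) ` I) 0"
    using order_continuousD assms(1) unfolding decreases_to_def oc_functional_def by blast
  then have g: "\<forall>i\<in>I. \<psi> s \<le> \<psi> (x i)" "\<And>u. \<forall>i\<in>I. u \<le> \<psi> (x i) - \<psi> s \<Longrightarrow> u \<le> 0"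
    by (auto simp: isGlb_iff linear_diff[OF oc_functional_linear[OF assms(1)]])
  have "u \<le> \<psi> s" if "\<forall>i\<in>I. u \<le> \<psi> (x i)" for u
    using g(2)[of "u - \<psi> s"] that by simp
  with g(1) show ?thesis by (auto simp: isGlb_iff)
qed

lemma isLub_uminus:
  fixes s :: "'a::ordered_real_vector"
  shows "isLub UNIV (uminus ` S) (- s) \<longleftrightarrow> isGlb UNIV S s"
proof -
  have "(\<forall>u. (\<forall>x\<in>S. - x \<le> u) \<longrightarrow> - s \<le> u) \<longleftrightarrow> (\<forall>u. (\<forall>x\<in>S. u \<le> x) \<longrightarrow> u \<le> s)"
    by (metis minus_le_iff neg_le_iff_le)
  then show ?thesis by (simp add: isLub_iff isGlb_iff)
qed

lemma isGlb_uminus: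
  fixes s :: "'a::ordered_real_vector"
  shows "isGlb UNIV (uminus ` S) (- s) \<longleftrightarrow> isLub UNIV S s"
  using isLub_uminus[of "uminus ` S" "- s"] by (simp add: image_image)

lemma oc_functional_isLub:
  assumes "oc_functional \<psi>" "increasing_net I r x" "isLub UNIV (x ` I) s"
  shows "isLub UNIV ((\<lambda>i. \<psi> (x i)) ` I) (\<psi> s)"
proof -
  have "isGlb UNIV ((\<lambda>i. - x i) ` I) (- s)"
    using assms(3) isGlb_uminus[of "x ` I" s] by (simp add: image_image)
  moreover have "decreasing_net I r (\<lambda>i. - x i)"
    using assms(2) by (simp add: decreasing_net_def increasing_net_def)
  ultimately have "isGlb UNIV ((\<lambda>i. \<psi> (- x i)) ` I) (\<psi> (- s))"
    using oc_functional_isGlb[OF assms(1)] by blast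
  then show ?thesis
    using isGlb_uminus[of "(\<lambda>i. \<psi> (x i)) ` I" "\<psi> s"]
    by (simp add: image_image linear_neg[OF oc_functional_linear[OF assms(1)]])
qed

lemma monotone_complete_isGlb:
  fixes x :: "'i \<Rightarrow> 'e::ordered_real_vector"
  assumes "monotone_complete TYPE('e)" "decreasing_net I r x" "bdd_below (x ` I)"
  shows "\<exists>s. isGlb UNIV (x ` I) s"
proof -
  have "increasing_net I r (\<lambda>i. - x i)"
    using assms(2) by (simp add: decreasing_net_def increasing_net_def)
  moreover have "bdd_above ((\<lambda>i. - x i) ` I)"
    using assms(3) by (auto simp: bdd_below_def bdd_above_def) (metis neg_le_iff_le)
  ultimately obtain s where "isLub UNIV ((\<lambda>i. - x i) ` I) s"
    using monotone_completeD[OF assms(1)] by blast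
  then have "isGlb UNIV (x ` I) (- s)"
    using isLub_uminus[of "x ` I" "- s"] by (simp add: image_image)
  then show ?thesis ..
qed

lemma increasing_net_seq: "incseq x \<Longrightarrow> increasing_net UNIV (\<le>) x"
proof -
  have "\<exists>k\<ge>i. j \<le> k" for i j :: nat by (rule exI[of _ "max i j"]) simp
  then show "incseq x \<Longrightarrow> ?thesis"
    by (auto simp: increasing_net_def directed_index_def incseq_def)
qed

lemma isLub_incseq_LIMSEQ:
  fixes x :: "nat \<Rightarrow> real"
  assumes "incseq x" "isLub UNIV (range x) s" shows "x \<longlonglongrightarrow> s"
proof (rule increasing_LIMSEQ)
  show "x n \<le> x (Suc n)" for n using assms(1) by (simp add: incseq_def)
  show "x n \<le> s" for n using assms(2) by (simp add: isLub_iff)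
  show "\<exists>n. s \<le> x n + e" if "0 < e" for e
  proof (rule ccontr)
    assume "\<nexists>n. s \<le> x n + e"
    then have "\<forall>n. x n \<le> s - e" by (metis le_diff_eq linear)
    then have "s \<le> s - e" using assms(2) by (auto simp: isLub_iff)
    with that show False by simp
  qed
qed

text \<open>Bridges order and topology: a supremum in \<open>'e\<close>, where no topology is given,
  becomes a limit of reals to which convergence theorems apply.\<close>

lemma oc_functional_LIMSEQ:
  fixes x :: "nat \<Rightarrow> 'e::ordered_real_vector"
  assumes "oc_functional \<psi>" "incseq x" "isLub UNIV (range x) s"
  shows "(\<lambda>n. \<psi> (x n)) \<longlonglongrightarrow> \<psi> s"
  using oc_functional_isLub[OF assms(1) increasing_net_seq[OF assms(2)] assms(3)]
    oc_functional_mono[OF assms(1)] assms(2)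
  by (intro isLub_incseq_LIMSEQ) (auto simp: incseq_def)

section \<open>Extended measures and the order integral\<close>

text \<open>The only additional upper bound in the extended space is \<open>Infty\<close>, which
  lies above everything and so does not disturb leastness.\<close>

lemma isLub_Fin: "isLub UNIV (Fin ` S) (Fin s) \<longleftrightarrow> isLub UNIV S s"
proof -
  have "(\<forall>u. (\<forall>x\<in>S. Fin x \<le> u) \<longrightarrow> Fin s \<le> u) \<longleftrightarrow> (\<forall>u. (\<forall>x\<in>S. x \<le> u) \<longrightarrow> s \<le> u)"
    by (metis ext.exhaust less_eq_ext.simps(1,2))
  then show ?thesis by (simp add: isLub_iff)
qed

text \<open>\<open>Infty\<close> is a lower bound of a set of finite elements only if that set is
  empty, which is why the empty set is excluded.\<close>

lemma isGlb_Fin: "S \<noteq> {} \<Longrightarrow> isGlb UNIV (Fin ` S) (Fin s) \<longleftrightarrow> isGlb UNIV S s"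
proof -
  assume "S \<noteq> {}"
  then have "(\<forall>u. (\<forall>x\<in>S. u \<le> Fin x) \<longrightarrow> u \<le> Fin s) \<longleftrightarrow> (\<forall>u. (\<forall>x\<in>S. u \<le> x) \<longrightarrow> u \<le> s)"
    by (metis ex_in_conv ext.exhaust less_eq_ext.simps(1,3))
  then show ?thesis by (simp add: isGlb_iff)
qed

lemma sum_Fin: "(\<Sum>i\<in>I. Fin (g i)) = Fin (\<Sum>i\<in>I. g i)"
  by (induction I rule: infinite_finite_induct) (auto simp: zero_ext_def)

lemma le_FinD: "x \<le> Fin y \<Longrightarrow> x = Fin (the_fin x)"
  by (cases x) auto

lemma ext_le_add: "0 \<le> y \<Longrightarrow> x \<le> x + y" for x y :: "'e::ordered_real_vector ext"
  by (cases x; cases y) (auto simp: zero_ext_def)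

context
  fixes \<mu> :: "'x::topological_space set \<Rightarrow> 'e::ordered_real_vector ext"
  assumes em: "ext_measure \<mu>"
begin

lemma ext_measure_nonneg: "A \<in> sets borel \<Longrightarrow> 0 \<le> \<mu> A"
  and ext_measure_empty: "\<mu> {} = 0"
  and ext_measure_UN: "\<And>A::nat \<Rightarrow> 'x set. range A \<subseteq> sets borel \<Longrightarrow> disjoint_family A \<Longrightarrow>
        isLub UNIV (range (\<lambda>N. \<Sum>n\<le>N. \<mu> (A n))) (\<mu> (\<Union>n. A n))"
  using em by (auto simp: ext_measure_def dest: PiE_mem)

text \<open>Finite additivity comes from the sequence \<open>A\<close>, \<open>B - A\<close>,
  \<open>{}\<close>, \<open>{}\<close>, ...: its partial sum over the indices 0 and 1 is bounded by
  the supremum \<open>\<mu> B\<close>. No subtraction occurs, so infinite values do no harm.\<close>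

lemma ext_measure_mono:
  assumes "A \<in> sets borel" "B \<in> sets borel" "A \<subseteq> B" shows "\<mu> A \<le> \<mu> B"
proof -
  define C :: "nat \<Rightarrow> 'x set" where "C n = (if n = 0 then A else if n = 1 then B - A else {})" for n
  have "range C \<subseteq> sets borel" "disjoint_family C"
    using assms by (auto simp: C_def disjoint_family_on_def)
  moreover have "(\<Union>n. C n) = B"
    using assms(3) by (auto simp: C_def split: if_splits)
  ultimately have "(\<Sum>n\<le>1. \<mu> (C n)) \<le> \<mu> B"
    using isLubD2[OF ext_measure_UN rangeI] by metis
  moreover have "(\<Sum>n\<le>1. \<mu> (C n)) = \<mu> A + \<mu> (B - A)"
    by (simp add: C_def)
  moreover have "\<mu> A \<le> \<mu> A + \<mu> (B - A)"
    using assms by (intro ext_le_add ext_measure_nonneg) auto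
  ultimately show ?thesis by (metis order_trans)
qed

end

section \<open>Scalar measures obtained by applying functionals\<close>

text \<open>
  Only meaningful if \<open>\<mu>\<close> is finite on \<open>S\<close>, since \<^const>\<open>the_fin\<close> is unspecified at \<open>\<infinity>\<close>. The restriction
  to \<open>S\<close> serves measures that are not yet known to be finite: for \<open>f\<close> in \<^const>\<open>Cc\<close> take \<open>S = supp f\<close>.
\<close>

definition trace_measure ::
  "('e::ordered_real_vector \<Rightarrow> real) \<Rightarrow> ('x::topological_space set \<Rightarrow> 'e ext) \<Rightarrow> 'x set \<Rightarrow> 'x measure" where
  "trace_measure \<psi> \<mu> S = measure_of UNIV (sets borel) (\<lambda>A. ennreal (\<psi> (the_fin (\<mu> (A \<inter> S)))))"

lemma sets_trace_measure [measurable_cong, simp]: "sets (trace_measure \<psi> \<mu> S) = sets borel"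
  and space_trace_measure [simp]: "space (trace_measure \<psi> \<mu> S) = UNIV"
  using sets.sets_measure_of_eq[of borel] by (simp_all add: trace_measure_def)

locale ext_measure_on =
  fixes \<mu> :: "'x::topological_space set \<Rightarrow> 'e::ordered_real_vector ext" and S s
  assumes em: "ext_measure \<mu>" and S: "S \<in> sets borel" and fin: "\<mu> S = Fin s"
begin

lemma Fin_the_fin:
  assumes "A \<in> sets borel" shows "\<mu> (A \<inter> S) = Fin (the_fin (\<mu> (A \<inter> S)))"
proof -
  have "\<mu> (A \<inter> S) \<le> Fin s"
    unfolding fin[symmetric] using assms S by (intro ext_measure_mono[OF em]) auto
  then show ?thesis by (rule le_FinD)
qed

lemma the_fin_nonneg:
  assumes "A \<in> sets borel" shows "0 \<le> the_fin (\<mu> (A \<inter> S))"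
  using ext_measure_nonneg[OF em, of "A \<inter> S"] Fin_the_fin[OF assms] assms S
  by (metis less_eq_ext.simps(1) sets.Int zero_ext_def)

context
  fixes \<psi> :: "'e \<Rightarrow> real"
  assumes \<psi>: "oc_functional \<psi>"
begin

text \<open>All values inside \<open>S\<close> are finite, so the supremum defining additivity lives
  in \<open>'e\<close>. The functional \<open>\<psi>\<close> turns it into the limit of the scalar
  partial sums.\<close>

lemma countably_additive_trace:
  "countably_additive (sets borel) (\<lambda>A. ennreal (\<psi> (the_fin (\<mu> (A \<inter> S)))))"
proof (rule countably_additiveI)
  fix A :: "nat \<Rightarrow> 'x set"
  assume A: "range A \<subseteq> sets borel" "disjoint_family A" "(\<Union>n. A n) \<in> sets borel"
  define m where "m B = the_fin (\<mu> (B \<inter> S))" for B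
  have mA: "\<mu> (A n \<inter> S) = Fin (m (A n))" "0 \<le> m (A n)" for n
    unfolding m_def using A(1) by (auto intro!: Fin_the_fin the_fin_nonneg)
  have "isLub UNIV (range (\<lambda>N. \<Sum>n\<le>N. \<mu> (A n \<inter> S))) (\<mu> (\<Union>n. A n \<inter> S))"
    using A(1,2) S by (intro ext_measure_UN[OF em]) (auto simp: disjoint_family_on_def)
  also have "(\<Union>n. A n \<inter> S) = (\<Union>n. A n) \<inter> S" by blast
  also have "\<mu> \<dots> = Fin (m (\<Union>n. A n))"
    unfolding m_def using A(3) by (rule Fin_the_fin)
  also have "(\<lambda>N. \<Sum>n\<le>N. \<mu> (A n \<inter> S)) = (\<lambda>N. Fin (\<Sum>n\<le>N. m (A n)))"
    by (simp add: mA(1) sum_Fin)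
  finally have "isLub UNIV (range (\<lambda>N. \<Sum>n\<le>N. m (A n))) (m (\<Union>n. A n))"
    using isLub_Fin[of "range (\<lambda>N. \<Sum>n\<le>N. m (A n))"] by (simp add: image_image)
  moreover have "incseq (\<lambda>N. \<Sum>n\<le>N. m (A n))"
    using mA(2) by (intro incseq_SucI) simp
  ultimately have "(\<lambda>N. \<psi> (\<Sum>n\<le>N. m (A n))) \<longlonglongrightarrow> \<psi> (m (\<Union>n. A n))"
    using oc_functional_LIMSEQ[OF \<psi>] by blast
  then have "(\<lambda>n. \<psi> (m (A n))) sums \<psi> (m (\<Union>n. A n))"
    by (simp add: sums_def_le linear_sum[OF oc_functional_linear[OF \<psi>]])
  then have "(\<Sum>n. ennreal (\<psi> (m (A n)))) = ennreal (\<psi> (m (\<Union>n. A n)))"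
    using mA(2) oc_functional_nonneg[OF \<psi>] by (intro suminf_ennreal_eq) auto
  then show "(\<Sum>n. ennreal (\<psi> (the_fin (\<mu> (A n \<inter> S))))) = ennreal (\<psi> (the_fin (\<mu> ((\<Union>n. A n) \<inter> S))))"
    by (simp add: m_def)
qed

lemma emeasure_trace:
  "A \<in> sets borel \<Longrightarrow> emeasure (trace_measure \<psi> \<mu> S) A = ennreal (\<psi> (the_fin (\<mu> (A \<inter> S))))"
  unfolding trace_measure_def using countably_additive_trace
  by (intro emeasure_measure_of_sigma)
    (use sets.sigma_algebra_axioms[of borel] in
      \<open>auto simp: positive_def ext_measure_empty[OF em] zero_ext_def linear_0[OF oc_functional_linear[OF \<psi>]]\<close>)

lemma measure_trace:
  "A \<in> sets borel \<Longrightarrow> measure (trace_measure \<psi> \<mu> S) A = \<psi> (the_fin (\<mu> (A \<inter> S)))"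
  using oc_functional_nonneg[OF \<psi> the_fin_nonneg] by (simp add: measure_def emeasure_trace)

lemma finite_measure_trace: "finite_measure (trace_measure \<psi> \<mu> S)"
  by (rule finite_measureI) (simp add: emeasure_trace)

lemma integrable_trace:
  "f \<in> borel_measurable borel \<Longrightarrow> (\<And>x. \<bar>f x\<bar> \<le> c) \<Longrightarrow> integrable (trace_measure \<psi> \<mu> S) f"
  for f :: "'x \<Rightarrow> real"
  by (rule finite_measure.integrable_const_bound[OF finite_measure_trace, of _ c])
    (auto cong: measurable_cong_sets)

end

text \<open>The elementary integral with every level set cut down to \<open>S\<close>, so that all
  its terms are finite and the sum can be formed in \<open>'e\<close>.\<close>

definition elem_value :: "('x \<Rightarrow> real) \<Rightarrow> 'e" where
  "elem_value \<phi> = (\<Sum>r\<in>range \<phi>. r *\<^sub>R the_fin (\<mu> (\<phi> -` {r} \<inter> S)))"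

lemma elementary_vimage: "elementary \<phi> \<Longrightarrow> \<phi> -` {r} \<in> sets borel"
  using simple_functionD(2)[of borel \<phi> "{r}"] by (simp add: elementary_def)

lemma elementary_integral_eq:
  assumes "elementary \<phi>" "{x. \<phi> x \<noteq> 0} \<subseteq> S"
  shows "elementary_integral \<mu> \<phi> = Fin (elem_value \<phi>)"
proof -
  have "ext_scale r (\<mu> (\<phi> -` {r})) = Fin (r *\<^sub>R the_fin (\<mu> (\<phi> -` {r} \<inter> S)))" for r
  proof (cases "r = 0")
    \<comment> \<open>The zero level set reaches outside \<open>S\<close> and may have measure
      \<open>Infty\<close>; the convention that \<open>ext_scale 0 Infty\<close> is 0 removes
      it.\<close>
    case True
    then show ?thesis by (cases "\<mu> (\<phi> -` {r})") (auto simp: zero_ext_def)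
  next
    case False
    then have "\<phi> -` {r} = \<phi> -` {r} \<inter> S" using assms(2) by auto
    then show ?thesis
      using Fin_the_fin[OF elementary_vimage[OF assms(1)], of r] by (metis ext_scale.simps(1))
  qed
  then show ?thesis
    by (simp add: elementary_integral_def elem_value_def sum_Fin)
qed

lemma functional_elem_value:
  assumes "elementary \<phi>" "oc_functional \<psi>"
  shows "\<psi> (elem_value \<phi>) = (\<integral>x. \<phi> x \<partial>trace_measure \<psi> \<mu> S)"
proof -
  have "simple_function (trace_measure \<psi> \<mu> S) \<phi>"
    using assms(1) by (simp add: elementary_def simple_function_def)
  moreover have "emeasure (trace_measure \<psi> \<mu> S) {x \<in> space (trace_measure \<psi> \<mu> S). \<phi> x \<noteq> 0} \<noteq> \<infinity>"
    using finite_measure.emeasure_finite[OF finite_measure_trace[OF assms(2)]] by simp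
  ultimately have "Bochner_Integration.simple_bochner_integrable (trace_measure \<psi> \<mu> S) \<phi>"
    by (rule simple_bochner_integrable.intros)
  then have "(\<integral>x. \<phi> x \<partial>trace_measure \<psi> \<mu> S) = Bochner_Integration.simple_bochner_integral (trace_measure \<psi> \<mu> S) \<phi>"
    by (rule simple_bochner_integrable_eq_integral[symmetric])
  also have "\<dots> = (\<Sum>r\<in>range \<phi>. r * \<psi> (the_fin (\<mu> (\<phi> -` {r} \<inter> S))))"
    unfolding simple_bochner_integral_def
    using elementary_vimage[OF assms(1)] measure_trace[OF assms(2)]
    by (intro sum.cong) (auto simp: vimage_def)
  also have "\<dots> = \<psi> (elem_value \<phi>)"
    unfolding elem_value_def using oc_functional_linear[OF assms(2)]
    by (simp add: linear_sum linear_scale)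
  finally show ?thesis ..
qed

text \<open>
  Every functional sends the suprema of two approximating sequences to the same scalar integral, which
  is why the order integral does not depend on the sequence.
\<close>

lemma elementary_approx_isLub:
  assumes mc: "monotone_complete TYPE('e)" and nm: "normal_space_order TYPE('e)"
    and f: "f \<in> borel_measurable borel" "\<And>x. 0 \<le> f x" "\<And>x. f x \<le> c" "{x. f x \<noteq> 0} \<subseteq> S"
    and \<phi>: "elementary_approx \<phi> (\<lambda>x. ennreal (f x))"
  obtains v where "isLub UNIV (range (\<lambda>n. elementary_integral \<mu> (\<phi> n))) (Fin v)"
    "\<And>\<psi>. oc_functional \<psi> \<Longrightarrow> \<psi> v = (\<integral>x. f x \<partial>trace_measure \<psi> \<mu> S)"
proof -
  have el: "elementary (\<phi> n)" and \<phi>0: "0 \<le> \<phi> n x" and inc: "incseq (\<lambda>n. \<phi> n x)"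
    and lim: "(\<lambda>n. \<phi> n x) \<longlonglongrightarrow> f x" for n x
    using \<phi> f(2) by (auto simp: elementary_approx_def elementary_def)
  have \<phi>f: "\<phi> n x \<le> f x" for n x
    using incseq_le[OF inc lim] .
  have meas: "\<phi> n \<in> borel_measurable borel" for n
    using el[of n] by (auto simp: elementary_def intro: borel_measurable_simple_function)
  have \<phi>S: "{x. \<phi> n x \<noteq> 0} \<subseteq> S" for n
  proof clarify
    fix x assume "\<phi> n x \<noteq> 0"
    then have "f x \<noteq> 0" using \<phi>0[of n x] \<phi>f[of n x] by auto
    then show "x \<in> S" using f(4) by blast
  qed
  have \<phi>c: "\<bar>\<phi> n x\<bar> \<le> c" for n x
    using \<phi>0[of n x] \<phi>f[of n x] f(3)[of x] by simp
  define w where "w n = elem_value (\<phi> n)" for n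
  have \<psi>w: "\<psi> (w n) = (\<integral>x. \<phi> n x \<partial>trace_measure \<psi> \<mu> S)" if "oc_functional \<psi>" for \<psi> n
    unfolding w_def using el that by (rule functional_elem_value)
  note int = integrable_trace[OF _ meas \<phi>c]
  \<comment> \<open>Testing with functionals replaces a common refinement of the level sets of
    consecutive functions by monotonicity of the scalar integral.\<close>
  have "incseq w"
  proof (rule incseq_SucI, unfold normal_le_iff[OF nm], intro allI impI)
    fix n and \<psi> :: "'e \<Rightarrow> real" assume \<psi>: "oc_functional \<psi>"
    have "\<phi> n x \<le> \<phi> (Suc n) x" for x
      using inc[of x] by (simp add: incseq_def)
    then show "\<psi> (w n) \<le> \<psi> (w (Suc n))"
      unfolding \<psi>w[OF \<psi>] by (intro integral_mono int \<psi>)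
  qed
  \<comment> \<open>The bound is the would-be integral of the constant \<open>c\<close> over
    \<open>S\<close>. It lets monotone completeness produce the supremum inside
    \<open>'e\<close>.\<close>
  moreover have "w n \<le> c *\<^sub>R s" for n
    unfolding normal_le_iff[OF nm]
  proof (intro allI impI)
    fix \<psi> :: "'e \<Rightarrow> real" assume \<psi>: "oc_functional \<psi>"
    have "\<psi> (w n) \<le> (\<integral>x. c \<partial>trace_measure \<psi> \<mu> S)"
      unfolding \<psi>w[OF \<psi>] using \<phi>c[of n]
      by (intro integral_mono int \<psi> finite_measure.integrable_const finite_measure_trace) (auto simp: abs_le_iff)
    also have "\<dots> = c * \<psi> s"
      using measure_trace[OF \<psi>, of UNIV] fin by simp
    finally show "\<psi> (w n) \<le> \<psi> (c *\<^sub>R s)"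
      by (simp add: linear_scale[OF oc_functional_linear[OF \<psi>]])
  qed
  then have "bdd_above (range w)" by (rule bdd_aboveI2)
  ultimately obtain v where v: "isLub UNIV (range w) v"
    using monotone_completeD[OF mc increasing_net_seq] by blast
  show ?thesis
  proof
    show "isLub UNIV (range (\<lambda>n. elementary_integral \<mu> (\<phi> n))) (Fin v)"
      using v isLub_Fin[of "range w" v] by (simp add: elementary_integral_eq[OF el \<phi>S] w_def image_image)
    fix \<psi> :: "'e \<Rightarrow> real" assume \<psi>: "oc_functional \<psi>"
    \<comment> \<open>The same real sequence has two limits: the scalar integral by dominated
      convergence, and \<open>\<psi> v\<close> by order continuity.\<close>
    have "(\<lambda>n. \<psi> (w n)) \<longlonglongrightarrow> (\<integral>x. f x \<partial>trace_measure \<psi> \<mu> S)"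
      unfolding \<psi>w[OF \<psi>]
    proof (rule integral_dominated_convergence[where w = "\<lambda>_. c"])
      show "integrable (trace_measure \<psi> \<mu> S) (\<lambda>_. c)"
        by (intro finite_measure.integrable_const finite_measure_trace \<psi>)
    qed (use f(1) meas lim \<phi>c in \<open>auto cong: measurable_cong_sets\<close>)
    then show "\<psi> v = (\<integral>x. f x \<partial>trace_measure \<psi> \<mu> S)"
      using oc_functional_LIMSEQ[OF \<psi> \<open>incseq w\<close> v] LIMSEQ_unique by blast
  qed
qed

lemma elementary_approx_exists:
  assumes "f \<in> borel_measurable borel" "\<And>x. 0 \<le> f x"
  obtains \<phi> where "elementary_approx \<phi> (\<lambda>x::'x. ennreal (f x))"
proof -
  obtain \<phi> where \<phi>: "incseq \<phi>" "\<And>i. simple_function borel (\<phi> i)"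
      "\<And>x. bdd_above (range (\<lambda>i. \<phi> i x))" "\<And>i x. 0 \<le> \<phi> i x" "f = (SUP i. \<phi> i)"
    using borel_measurable_implies_simple_function_sequence_real[OF assms] by metis
  have inc: "incseq (\<lambda>n. \<phi> n x)" for x
    using \<phi>(1) by (auto simp: incseq_def le_fun_def)
  have "f x = (SUP i. \<phi> i x)" for x
    unfolding \<phi>(5) by (simp add: image_comp)
  then have "(\<lambda>n. \<phi> n x) \<longlonglongrightarrow> f x" for x
    using LIMSEQ_incseq_SUP[OF \<phi>(3)[of x] inc] by simp
  then have "elementary_approx \<phi> (\<lambda>x. ennreal (f x))"
    using \<phi>(2,4) inc by (auto simp: elementary_approx_def elementary_def)
  then show ?thesis by (rule that)
qed

lemma order_nn_integral_eq:
  assumes mc: "monotone_complete TYPE('e)" and nm: "normal_space_order TYPE('e)"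
    and f: "f \<in> borel_measurable borel" "\<And>x. 0 \<le> f x" "\<And>x. f x \<le> c" "{x. f x \<noteq> 0} \<subseteq> S"
  obtains v where "order_nn_integral \<mu> (\<lambda>x. ennreal (f x)) = Fin v"
    "\<And>\<psi>. oc_functional \<psi> \<Longrightarrow> \<psi> v = (\<integral>x. f x \<partial>trace_measure \<psi> \<mu> S)"
proof -
  obtain \<phi> where \<phi>: "elementary_approx \<phi> (\<lambda>x. ennreal (f x))"
    using elementary_approx_exists f(1,2) by blast
  obtain v where v: "isLub UNIV (range (\<lambda>n. elementary_integral \<mu> (\<phi> n))) (Fin v)"
    "\<And>\<psi>. oc_functional \<psi> \<Longrightarrow> \<psi> v = (\<integral>x. f x \<partial>trace_measure \<psi> \<mu> S)"
    using elementary_approx_isLub[OF mc nm f \<phi>] by blast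
  have "t = Fin v" if t: "elementary_approx \<phi>' (\<lambda>x. ennreal (f x))"
    "isLub UNIV (range (\<lambda>n. elementary_integral \<mu> (\<phi>' n))) t" for \<phi>' t
  proof -
    obtain v' where v': "isLub UNIV (range (\<lambda>n. elementary_integral \<mu> (\<phi>' n))) (Fin v')"
      "\<And>\<psi>. oc_functional \<psi> \<Longrightarrow> \<psi> v' = (\<integral>x. f x \<partial>trace_measure \<psi> \<mu> S)"
      using elementary_approx_isLub[OF mc nm f t(1)] by blast
    have "v' = v"
      using normal_eqI[OF nm] v(2) v'(2) by metis
    then show ?thesis using isLub_unique_order[OF t(2) v'(1)] by simp
  qed
  then have "order_nn_integral \<mu> (\<lambda>x. ennreal (f x)) = Fin v"
    unfolding order_nn_integral_def using \<phi> v(1) by (intro the_equality) blast+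
  then show ?thesis using that v(2) by blast
qed

end

text \<open>The integrals of \<open>\<bar>f\<bar>\<close> and of the positive and negative parts are
  carried by \<open>S\<close> and bounded, hence finite. The second claim makes the order integral
  accessible: by normality these scalars determine it.\<close>

lemma order_integral_Cc:
  fixes \<mu> :: "'x::t2_space set \<Rightarrow> 'e::ordered_real_vector ext"
  assumes mc: "monotone_complete TYPE('e)" and nm: "normal_space_order TYPE('e)"
    and \<mu>: "ext_measure_on \<mu> S s" and f: "f \<in> Cc" "supp f \<subseteq> S"
  shows "order_integrable \<mu> f"
    and "oc_functional \<psi> \<Longrightarrow> \<psi> (order_integral \<mu> f) = (\<integral>x. f x \<partial>trace_measure \<psi> \<mu> S)"
proof -
  interpret ext_measure_on \<mu> S s by fact
  have meas [measurable]: "f \<in> borel_measurable borel" using f(1) by (rule Cc_measurable)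
  obtain c where c: "\<And>x. \<bar>f x\<bar> \<le> c" "0 < c" using Cc_bounded[OF f(1)] by blast
  have S: "{x. f x \<noteq> 0} \<subseteq> S"
    using f(2) not_in_supp[of _ f] by blast
  obtain a where a: "order_nn_integral \<mu> (\<lambda>x. ennreal \<bar>f x\<bar>) = Fin a"
    by (rule order_nn_integral_eq[OF mc nm, of "\<lambda>x. \<bar>f x\<bar>" c]) (use c S in auto)
  then show "order_integrable \<mu> f"
    using meas by (simp add: order_integrable_def)
  obtain p where p: "order_nn_integral \<mu> (\<lambda>x. ennreal (max (f x) 0)) = Fin p"
    "\<And>\<psi>. oc_functional \<psi> \<Longrightarrow> \<psi> p = (\<integral>x. max (f x) 0 \<partial>trace_measure \<psi> \<mu> S)"
    by (rule order_nn_integral_eq[OF mc nm, of "\<lambda>x. max (f x) 0" c]) (use c S in \<open>auto simp: abs_le_iff\<close>)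
  obtain q where q: "order_nn_integral \<mu> (\<lambda>x. ennreal (max (- f x) 0)) = Fin q"
    "\<And>\<psi>. oc_functional \<psi> \<Longrightarrow> \<psi> q = (\<integral>x. max (- f x) 0 \<partial>trace_measure \<psi> \<mu> S)"
    by (rule order_nn_integral_eq[OF mc nm, of "\<lambda>x. max (- f x) 0" c]) (use c S in \<open>auto simp: abs_le_iff\<close>)
  assume \<psi>: "oc_functional \<psi>"
  have "\<psi> (order_integral \<mu> f) = \<psi> p - \<psi> q"
    by (simp add: order_integral_def p(1) q(1) linear_diff[OF oc_functional_linear[OF \<psi>]])
  also have "\<dots> = (\<integral>x. max (f x) 0 - max (- f x) 0 \<partial>trace_measure \<psi> \<mu> S)"
    unfolding p(2)[OF \<psi>] q(2)[OF \<psi>] using c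
    by (intro Bochner_Integration.integral_diff[symmetric] integrable_trace[OF \<psi>, of _ c])
      (auto simp: abs_le_iff)
  also have "\<dots> = (\<integral>x. f x \<partial>trace_measure \<psi> \<mu> S)"
    by (intro Bochner_Integration.integral_cong) auto
  finally show "\<psi> (order_integral \<mu> f) = (\<integral>x. f x \<partial>trace_measure \<psi> \<mu> S)" .
qed

text \<open>If \<open>\<mu> V\<close> is infinite there is nothing to prove. Otherwise the trace on
  \<open>V\<close> is a finite measure of total mass \<open>\<psi> v\<close>, and
  \<open>f \<le> 1\<close>.\<close>

lemma order_integral_le_open:
  fixes \<mu> :: "'x::t2_space set \<Rightarrow> 'e::ordered_real_vector ext"
  assumes mc: "monotone_complete TYPE('e)" and nm: "normal_space_order TYPE('e)"
    and \<mu>: "ext_measure \<mu>" and f: "prec_set f V" and V: "open V"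
  shows "Fin (order_integral \<mu> f) \<le> \<mu> V"
proof (cases "\<mu> V")
  case (Fin v)
  interpret ext_measure_on \<mu> V v
    using \<mu> V Fin by unfold_locales auto
  have f': "f \<in> Cc" "\<And>x. f x \<le> 1" "\<And>x. 0 \<le> f x" "supp f \<subseteq> V"
    using f by (auto simp: prec_set_def)
  have "\<psi> (order_integral \<mu> f) \<le> \<psi> v" if \<psi>: "oc_functional \<psi>" for \<psi>
  proof -
    have "\<psi> (order_integral \<mu> f) = (\<integral>x. f x \<partial>trace_measure \<psi> \<mu> V)"
      by (rule order_integral_Cc(2)[OF mc nm ext_measure_on_axioms f'(1,4) \<psi>])
    also have "\<dots> \<le> (\<integral>x. 1 \<partial>trace_measure \<psi> \<mu> V)"
      using f'(2,3)
      by (intro integral_mono integrable_trace[OF \<psi> Cc_measurable[OF f'(1)], of 1]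
          integrable_trace[OF \<psi> borel_measurable_const, of _ 1]) auto
    also have "\<dots> = \<psi> v"
      using measure_trace[OF \<psi>, of UNIV] Fin by simp
    finally show ?thesis .
  qed
  then show ?thesis by (simp add: Fin normal_le_iff[OF nm])
qed simp

text \<open>The trace is taken on \<open>supp f\<close>, which is compact and hence of finite
  measure, and which contains \<open>K\<close> because \<open>f = 1\<close> there.\<close>

lemma le_order_integral_compact:
  fixes \<mu> :: "'x::t2_space set \<Rightarrow> 'e::ordered_real_vector ext"
  assumes mc: "monotone_complete TYPE('e)" and nm: "normal_space_order TYPE('e)"
    and \<mu>: "ext_measure \<mu>" and fin: "\<And>K. compact K \<Longrightarrow> \<mu> K \<in> range Fin"
    and f: "set_prec K f" and K: "compact K"
  shows "\<mu> K \<le> Fin (order_integral \<mu> f)"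
proof -
  have f': "f \<in> Cc" "\<And>x. f x \<le> 1" "\<And>x. 0 \<le> f x" "\<And>x. x \<in> K \<Longrightarrow> f x = 1"
    using f by (auto simp: set_prec_def)
  obtain s where s: "\<mu> (supp f) = Fin s"
    using fin[OF Cc_compact[OF f'(1)]] by blast
  obtain k where k: "\<mu> K = Fin k"
    using fin[OF K] by blast
  interpret ext_measure_on \<mu> "supp f" s
    using \<mu> s by unfold_locales (auto intro: borel_closed closed_supp)
  have bK: "K \<in> sets borel" using K by (simp add: compact_imp_closed)
  have "K \<inter> supp f = K"
    using f'(4) not_in_supp[of _ f] by fastforce
  have "\<psi> k \<le> \<psi> (order_integral \<mu> f)" if \<psi>: "oc_functional \<psi>" for \<psi>
  proof -
    have "\<psi> k = (\<integral>x. indicator K x \<partial>trace_measure \<psi> \<mu> (supp f))"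
      using measure_trace[OF \<psi> bK] \<open>K \<inter> supp f = K\<close> k bK by simp
    also have "\<dots> \<le> (\<integral>x. f x \<partial>trace_measure \<psi> \<mu> (supp f))"
      using f' bK by (intro integral_mono integrable_trace[OF \<psi>, of _ 1] Cc_measurable borel_measurable_indicator)
        (auto simp: indicator_def)
    also have "\<dots> = \<psi> (order_integral \<mu> f)"
      by (rule order_integral_Cc(2)[OF mc nm ext_measure_on_axioms f'(1) order_refl \<psi>, symmetric])
    finally show ?thesis .
  qed
  then show ?thesis by (simp add: k normal_le_iff[OF nm])
qed

section \<open>Uniqueness\<close>

context
  fixes \<mu> :: "'x::t2_space set \<Rightarrow> 'e::ordered_real_vector ext" and \<pi> :: "('x \<Rightarrow> real) \<Rightarrow> 'e"
  assumes lc: "locally_compact_space (euclidean :: 'x topology)"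
    and mc: "monotone_complete TYPE('e)" and nm: "normal_space_order TYPE('e)"
    and reg: "regular_borel_measure \<mu>" and rep: "represents \<mu> \<pi>"
begin

lemma representing_le_open: "prec_set f V \<Longrightarrow> open V \<Longrightarrow> Fin (\<pi> f) \<le> \<mu> V"
  using order_integral_le_open[OF mc nm] reg rep
  by (auto simp: regular_borel_measure_def represents_def prec_set_def)

lemma compact_le_representing: "set_prec K f \<Longrightarrow> compact K \<Longrightarrow> \<mu> K \<le> Fin (\<pi> f)"
  using le_order_integral_compact[OF mc nm] reg rep
  by (auto simp: regular_borel_measure_def represents_def set_prec_def)

text \<open>Formulated in the extended space, since \<open>\<mu> V\<close> may still be infinite at
  this stage.\<close>

lemma representing_open:
  assumes V: "open V" shows "isLub UNIV (Fin ` {\<pi> f |f. prec_set f V}) (\<mu> V)"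
proof -
  have "\<mu> V \<le> u" if u: "\<And>f. prec_set f V \<Longrightarrow> Fin (\<pi> f) \<le> u" for u
  proof -
    have "\<mu> K \<le> u" if K: "compact K" "K \<subseteq> V" for K
    proof -
      obtain f where f: "set_prec K f" "prec_set f V"
        by (rule Urysohn_Cc[OF lc K(1) V K(2)])
      show ?thesis
        using compact_le_representing[OF f(1) K(1)] u[OF f(2)] by (rule order_trans)
    qed
    moreover have "inner_regular_at \<mu> V"
      using reg V by (simp add: regular_borel_measure_def)
    ultimately show ?thesis
      unfolding inner_regular_at_def by (elim isLub_least) auto
  qed
  then show ?thesis
    using representing_le_open[OF _ V] unfolding isLub_iff by blast
qed

text \<open>Dual to the open case, with outer regularity at \<open>K\<close> in place of inner
  regularity. The value is finite by the definition of a Borel measure, so the infimum can be stated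
  in \<open>'e\<close>.\<close>

lemma representing_compact:
  assumes K: "compact K" shows "\<exists>k. \<mu> K = Fin k \<and> isGlb UNIV {\<pi> f |f. set_prec K f} k"
proof -
  obtain k where k: "\<mu> K = Fin k"
    using reg K by (auto simp: regular_borel_measure_def)
  have "u \<le> k" if u: "\<And>f. set_prec K f \<Longrightarrow> u \<le> \<pi> f" for u
  proof -
    have "Fin u \<le> \<mu> V" if V: "open V" "K \<subseteq> V" for V
    proof -
      obtain f where f: "set_prec K f" "prec_set f V"
        by (rule Urysohn_Cc[OF lc K V])
      have "Fin u \<le> Fin (\<pi> f)" using u[OF f(1)] by simp
      also have "\<dots> \<le> \<mu> V" by (rule representing_le_open[OF f(2) V(1)])
      finally show ?thesis .
    qed
    moreover have "outer_regular_at \<mu> K"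
      using reg K by (simp add: regular_borel_measure_def compact_imp_closed)
    ultimately have "Fin u \<le> \<mu> K"
      unfolding outer_regular_at_def by (elim isGlb_greatest) auto
    then show ?thesis by (simp add: k)
  qed
  then have "isGlb UNIV {\<pi> f |f. set_prec K f} k"
    using compact_le_representing[OF _ K] by (auto simp: isGlb_iff k)
  with k show ?thesis by blast
qed

text \<open>The bound on the unit ball also bounds all \<open>\<pi> f\<close> with \<open>f\<close>
  below \<open>V\<close>, so their supremum in the extended space cannot be
  \<open>Infty\<close>.\<close>

lemma representing_open_finite:
  assumes bdd: "bdd_above {\<pi> f |f. f \<in> Cc \<and> (\<forall>x. 0 \<le> f x) \<and> sup_norm f \<le> 1}" and V: "open V"
  shows "\<exists>v. \<mu> V = Fin v \<and> isLub UNIV {\<pi> f |f. prec_set f V} v"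
proof -
  obtain b where b: "\<And>f. f \<in> Cc \<Longrightarrow> \<forall>x. 0 \<le> f x \<Longrightarrow> sup_norm f \<le> 1 \<Longrightarrow> \<pi> f \<le> b"
    using bdd by (auto simp: bdd_above_def)
  have "\<pi> f \<le> b" if "prec_set f V" for f
    using that prec_set_sup_norm[OF that] by (intro b) (auto simp: prec_set_def)
  then have "\<mu> V \<le> Fin b"
    by (intro isLub_least[OF representing_open[OF V]]) auto
  then obtain v where v: "\<mu> V = Fin v" by (cases "\<mu> V") auto
  then have "isLub UNIV {\<pi> f |f. prec_set f V} v"
    using representing_open[OF V] by (simp only: isLub_Fin)
  with v show ?thesis by blast
qed

lemma representing_finite:
  assumes "bdd_above {\<pi> f |f. f \<in> Cc \<and> (\<forall>x. 0 \<le> f x) \<and> sup_norm f \<le> 1}"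
  shows "finite_ext_measure \<mu>"
proof -
  have em: "ext_measure \<mu>" using reg by (simp add: regular_borel_measure_def)
  obtain v where v: "\<mu> UNIV = Fin v"
    using representing_open_finite[OF assms open_UNIV] by blast
  moreover have "0 \<le> v"
    using ext_measure_nonneg[OF em, of UNIV] by (simp add: v zero_ext_def)
  ultimately show ?thesis using em by (simp add: finite_ext_measure_def)
qed

end

lemma representing_unique:
  fixes \<mu> \<mu>' :: "'x::t2_space set \<Rightarrow> 'e::ordered_real_vector ext"
  assumes "locally_compact_space (euclidean :: 'x topology)"
    and "monotone_complete TYPE('e)" "normal_space_order TYPE('e)"
    and \<mu>: "regular_borel_measure \<mu>" "represents \<mu> \<pi>"
    and \<mu>': "regular_borel_measure \<mu>'" "represents \<mu>' \<pi>"
  shows "\<mu> = \<mu>'"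
proof -
  have eqV: "\<mu> V = \<mu>' V" if "open V" for V
    using representing_open[OF assms(1-3) \<mu> that] representing_open[OF assms(1-3) \<mu>' that]
    by (rule isLub_unique_order)
  have eq: "{\<mu> V |V. open V \<and> A \<subseteq> V} = {\<mu>' V |V. open V \<and> A \<subseteq> V}" for A
    by (intro Collect_cong ex_cong1) (auto simp: eqV)
  have "\<mu> A = \<mu>' A" if "A \<in> sets borel" for A
  proof -
    have "isGlb UNIV {\<mu> V |V. open V \<and> A \<subseteq> V} (\<mu> A)"
      "isGlb UNIV {\<mu>' V |V. open V \<and> A \<subseteq> V} (\<mu>' A)"
      using \<mu>(1) \<mu>'(1) that by (simp_all add: regular_borel_measure_def outer_regular_at_def)
    then show ?thesis
      unfolding eq by (rule isGlb_unique_order)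
  qed
  \<comment> \<open>Equality of functions also concerns non-Borel sets, where both measures have the
    default value \<open>undefined\<close>.\<close>
  moreover have "\<mu> \<in> extensional (sets borel)" "\<mu>' \<in> extensional (sets borel)"
    using \<mu>(1) \<mu>'(1) by (auto simp: regular_borel_measure_def ext_measure_def PiE_def)
  ultimately show ?thesis by (intro extensionalityI)
qed

section \<open>Existence\<close>

lemma positive_operator_comp:
  assumes "positive_operator_Cc \<pi>" "oc_functional \<psi>"
  shows "positive_operator_Cc (\<lambda>f. \<psi> (\<pi> f))"
  using assms oc_functional_nonneg[OF assms(2)] oc_functional_linear[OF assms(2)]
  by (simp add: positive_operator_Cc_def linear_add linear_scale)

locale bounded_positive_operator =
  fixes \<pi> :: "('x::t2_space \<Rightarrow> real) \<Rightarrow> 'e::ordered_real_vector" and b :: 'e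
  assumes lc: "locally_compact_space (euclidean :: 'x topology)"
    and mc: "monotone_complete TYPE('e)" and nm: "normal_space_order TYPE('e)"
    and pos: "positive_operator_Cc \<pi>"
    and bounded: "prec_set f UNIV \<Longrightarrow> \<pi> f \<le> b"
begin

text \<open>The choice operator hides no freedom: the bound exists by monotone completeness and is
  unique by antisymmetry.\<close>

definition open_value :: "'x set \<Rightarrow> 'e" where
  "open_value V = (SOME s. isLub UNIV (\<pi> ` {f. prec_set f V}) s)"

definition outer_value :: "'x set \<Rightarrow> 'e" where
  "outer_value A = (SOME s. isGlb UNIV (open_value ` {V. open V \<and> A \<subseteq> V}) s)"

definition operator_measure :: "'x set \<Rightarrow> 'e ext" where
  "operator_measure A = (if A \<in> sets borel then Fin (outer_value A) else undefined)"

section \<open>Existence of the defining suprema and infima\<close>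

lemma increasing_net_prec: "increasing_net {f. prec_set f V} (\<le>) \<pi>"
proof -
  have "\<exists>h. prec_set h V \<and> f \<le> h \<and> g \<le> h" if "prec_set f V" "prec_set g V" for f g
    using prec_set_max[OF that] by (intro exI[of _ "\<lambda>x. max (f x) (g x)"]) (auto simp: le_fun_def)
  moreover have "\<pi> f \<le> \<pi> g" if "prec_set f V" "prec_set g V" "f \<le> g" for f g
    using that by (intro positive_operator_mono[OF pos]) (auto simp: prec_set_def le_fun_def)
  ultimately show ?thesis
    using prec_set_zero[of V] by (auto simp: increasing_net_def directed_index_def)
qed

lemma open_value: "isLub UNIV (\<pi> ` {f. prec_set f V}) (open_value V)"
proof -
  have "bdd_above (\<pi> ` {f. prec_set f V})"
    by (rule bdd_aboveI2[of _ _ b]) (simp add: bounded[OF prec_set_mono[OF _ subset_UNIV]])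
  then show ?thesis
    unfolding open_value_def by (rule someI_ex[OF monotone_completeD[OF mc increasing_net_prec]])
qed

lemma le_open_value: "prec_set f V \<Longrightarrow> \<pi> f \<le> open_value V"
  using open_value[of V] by (auto simp: isLub_iff)

lemma open_value_le: "(\<And>f. prec_set f V \<Longrightarrow> \<pi> f \<le> u) \<Longrightarrow> open_value V \<le> u"
  by (rule isLub_least[OF open_value]) auto

lemma open_value_mono: "V \<subseteq> W \<Longrightarrow> open_value V \<le> open_value W"
  by (rule open_value_le, rule le_open_value, rule prec_set_mono)

lemma open_value_nonneg: "0 \<le> open_value V"
  using le_open_value[OF prec_set_zero] positive_operator_zero[OF pos] by simp

lemma decreasing_net_open:
  "decreasing_net {V. open V \<and> A \<subseteq> V} (\<lambda>V W. W \<subseteq> V) open_value"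
proof -
  have "\<exists>U. open U \<and> A \<subseteq> U \<and> U \<subseteq> V \<and> U \<subseteq> W" if "open V" "A \<subseteq> V" "open W" "A \<subseteq> W" for V W
    using that by (intro exI[of _ "V \<inter> W"]) auto
  then show ?thesis
    by (auto simp: decreasing_net_def directed_index_def intro: open_value_mono)
qed

lemma outer_value: "isGlb UNIV (open_value ` {V. open V \<and> A \<subseteq> V}) (outer_value A)"
proof -
  have "bdd_below (open_value ` {V. open V \<and> A \<subseteq> V})"
    using open_value_nonneg by (intro bdd_belowI2[of _ 0]) auto
  then show ?thesis
    unfolding outer_value_def by (rule someI_ex[OF monotone_complete_isGlb[OF mc decreasing_net_open]])
qed

lemma outer_value_nonneg: "0 \<le> outer_value A"
  by (rule isGlb_greatest[OF outer_value]) (auto simp: open_value_nonneg)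

lemma outer_value_le: "open V \<Longrightarrow> A \<subseteq> V \<Longrightarrow> outer_value A \<le> open_value V"
  using isGlbD2[OF outer_value[of A]] by auto

lemma outer_value_open: "open V \<Longrightarrow> outer_value V = open_value V"
  by (rule isGlb_unique_order[OF outer_value]) (auto simp: isGlb_iff intro: open_value_mono)

section \<open>Comparison with the scalar Riesz measures\<close>

lemma functional_bounded:
  assumes "oc_functional \<psi>"
  shows "bounded_positive_Cc_functional (\<lambda>f. \<psi> (\<pi> f)) (\<psi> b)"
  using lc positive_operator_comp[OF pos assms] bounded oc_functional_mono[OF assms]
  by unfold_locales auto

context
  fixes \<psi> :: "'e \<Rightarrow> real"
  assumes \<psi>: "oc_functional \<psi>"
begin

interpretation R: bounded_positive_Cc_functional "\<lambda>f. \<psi> (\<pi> f)" "\<psi> b"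
  by (rule functional_bounded[OF \<psi>])

abbreviation scalar_measure :: "'x measure" where
  "scalar_measure \<equiv> positive_Cc_functional.riesz_measure (\<lambda>f. \<psi> (\<pi> f))"

text \<open>One inequality holds because \<open>\<psi>\<close> is monotone. The other is order
  continuity: \<open>\<psi>\<close> of the supremum in \<open>'e\<close> is the supremum of the
  numbers \<open>\<psi> (\<pi> f)\<close>, each of which is at most the scalar measure of
  \<open>V\<close>.\<close>

lemma measure_open:
  assumes V: "open V" shows "measure scalar_measure V = \<psi> (open_value V)"
proof (rule antisym)
  have "emeasure scalar_measure V \<le> ennreal (\<psi> (open_value V))"
    unfolding R.emeasure_riesz_measure_open[OF V]
    by (intro R.open_content_le ennreal_leI oc_functional_mono[OF \<psi>] le_open_value)
  then show "measure scalar_measure V \<le> \<psi> (open_value V)"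
    using oc_functional_nonneg[OF \<psi> open_value_nonneg] by (simp add: R.emeasure_eq_measure)
  have "isLub UNIV ((\<lambda>f. \<psi> (\<pi> f)) ` {f. prec_set f V}) (\<psi> (open_value V))"
    by (rule oc_functional_isLub[OF \<psi> increasing_net_prec open_value])
  then show "\<psi> (open_value V) \<le> measure scalar_measure V"
    by (rule isLub_least) (auto intro: R.le_measure_open[OF V])
qed

text \<open>Order continuity along the decreasing net of open supersets makes the infimum in
  \<open>'e\<close> agree with the scalar one. Through this identity the Borel values inherit
  additivity from the scalar theory.\<close>

lemma measure_outer:
  assumes A: "A \<in> sets borel" shows "measure scalar_measure A = \<psi> (outer_value A)"
proof (rule antisym)
  have "measure scalar_measure A \<le> \<psi> (open_value V)" if "open V" "A \<subseteq> V" for V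
    unfolding measure_open[OF that(1), symmetric] using that by (intro R.finite_measure_mono) auto
  then show "measure scalar_measure A \<le> \<psi> (outer_value A)"
    by (intro isGlb_greatest[OF oc_functional_isGlb[OF \<psi> decreasing_net_open outer_value]]) auto
  have "ennreal (\<psi> (outer_value A)) \<le> R.open_content V" if V: "open V" "A \<subseteq> V" for V
  proof -
    have "outer_value A \<le> open_value V"
      using V by (rule outer_value_le)
    then show ?thesis
      unfolding R.emeasure_riesz_measure_open[OF V(1), symmetric]
      by (simp add: R.emeasure_eq_measure measure_open[OF V(1)] ennreal_leI oc_functional_mono[OF \<psi>])
  qed
  then have "ennreal (\<psi> (outer_value A)) \<le> emeasure scalar_measure A"
    unfolding R.emeasure_riesz_measure[OF A] R.outer_content_def by (auto intro: INF_greatest)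
  then show "\<psi> (outer_value A) \<le> measure scalar_measure A"
    using oc_functional_nonneg[OF \<psi> outer_value_nonneg] by (simp add: R.emeasure_eq_measure)
qed

lemma outer_value_sums:
  fixes A :: "nat \<Rightarrow> 'x set"
  assumes "range A \<subseteq> sets borel" "disjoint_family A"
  shows "(\<lambda>n. \<psi> (outer_value (A n))) sums \<psi> (outer_value (\<Union>n. A n))"
proof -
  have "(\<lambda>n. measure scalar_measure (A n)) sums measure scalar_measure (\<Union>n. A n)"
    using assms by (intro R.finite_measure_UNION) auto
  then show ?thesis
    using assms(1) by (simp add: measure_outer range_subsetD sets.countable_UN)
qed

lemma functional_integral: "f \<in> Cc \<Longrightarrow> \<psi> (\<pi> f) = (\<integral>x. f x \<partial>scalar_measure)"
  by (rule R.representation)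

end

section \<open>Measure property, regularity and representation\<close>

lemma ext_measure_operator_measure: "ext_measure operator_measure"
  unfolding ext_measure_def
proof (intro conjI allI impI)
  show "operator_measure \<in> sets borel \<rightarrow>\<^sub>E {0..}"
    by (auto simp: operator_measure_def zero_ext_def outer_value_nonneg)
  have "open_value {} = 0"
  proof -
    have "\<pi> f = 0" if "prec_set f {}" for f
      using prec_set_emptyD[OF that] positive_operator_zero[OF pos] by simp
    then show ?thesis
      using open_value_nonneg by (intro antisym open_value_le) auto
  qed
  then show "operator_measure {} = 0"
    by (simp add: operator_measure_def outer_value_open zero_ext_def)
  fix A :: "nat \<Rightarrow> 'x set"
  assume A: "range A \<subseteq> sets borel" "disjoint_family A"
  define p where "p N = (\<Sum>n\<le>N. outer_value (A n))" for N
  have \<psi>p: "\<psi> (p N) = (\<Sum>n\<le>N. \<psi> (outer_value (A n)))" if "oc_functional \<psi>" for \<psi> N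
    unfolding p_def by (rule linear_sum[OF oc_functional_linear[OF that]])
  have "isLub UNIV (range p) (outer_value (\<Union>n. A n))"
    unfolding isLub_iff
  proof (intro conjI ballI allI impI)
    fix x assume "x \<in> range p"
    then obtain N where "x = p N" by blast
    then show "x \<le> outer_value (\<Union>n. A n)"
      unfolding normal_le_iff[OF nm]
    proof (intro allI impI)
      fix \<psi> :: "'e \<Rightarrow> real" assume \<psi>: "oc_functional \<psi>"
      have "(\<Sum>n\<le>N. \<psi> (outer_value (A n))) \<le> (\<Sum>n. \<psi> (outer_value (A n)))"
        using sums_summable[OF outer_value_sums[OF \<psi> A]] oc_functional_nonneg[OF \<psi> outer_value_nonneg]
        by (intro sum_le_suminf) auto
      then show "\<psi> x \<le> \<psi> (outer_value (\<Union>n. A n))"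
        using sums_unique[OF outer_value_sums[OF \<psi> A]] by (simp add: \<open>x = p N\<close> \<psi>p[OF \<psi>])
    qed
  next
    fix u assume u: "\<forall>x\<in>range p. x \<le> u"
    show "outer_value (\<Union>n. A n) \<le> u"
      unfolding normal_le_iff[OF nm]
    proof (intro allI impI)
      fix \<psi> :: "'e \<Rightarrow> real" assume \<psi>: "oc_functional \<psi>"
      have "\<psi> (p N) \<le> \<psi> u" for N
        using u by (intro oc_functional_mono[OF \<psi>]) auto
      moreover have "(\<lambda>N. \<psi> (p N)) \<longlonglongrightarrow> \<psi> (outer_value (\<Union>n. A n))"
        using outer_value_sums[OF \<psi> A] by (simp add: \<psi>p[OF \<psi>] sums_def_le)
      ultimately show "\<psi> (outer_value (\<Union>n. A n)) \<le> \<psi> u"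
        by (intro LIMSEQ_le_const2) auto
    qed
  qed
  then have "isLub UNIV (range (\<lambda>N. Fin (p N))) (Fin (outer_value (\<Union>n. A n)))"
    using isLub_Fin[of "range p"] by (simp add: image_image)
  moreover have "(\<Sum>n\<le>N. operator_measure (A n)) = Fin (p N)" for N
    using A(1) by (simp add: operator_measure_def range_subsetD p_def sum_Fin)
  moreover have "operator_measure (\<Union>n. A n) = Fin (outer_value (\<Union>n. A n))"
    using A(1) by (simp add: operator_measure_def sets.countable_UN)
  ultimately show "isLub UNIV (range (\<lambda>N. \<Sum>n\<le>N. operator_measure (A n))) (operator_measure (\<Union>n. A n))"
    by simp
qed

lemma operator_measure_open: "open V \<Longrightarrow> operator_measure V = Fin (open_value V)"
  by (simp add: operator_measure_def outer_value_open)

lemma operator_measure_compact: "compact K \<Longrightarrow> operator_measure K = Fin (outer_value K)"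
  by (simp add: operator_measure_def compact_imp_closed)

text \<open>For \<open>f\<close> below \<open>V\<close> the set \<open>supp f\<close> is itself a
  sufficiently large compact set: \<open>f\<close> lies below every open \<open>W\<close> containing
  \<open>supp f\<close>, so \<open>\<pi> f \<le> outer_value (supp f)\<close>.\<close>

lemma inner_regular_operator_measure:
  assumes V: "open V" shows "inner_regular_at operator_measure V"
proof -
  have least: "operator_measure V \<le> u" if u: "\<And>K. compact K \<Longrightarrow> K \<subseteq> V \<Longrightarrow> operator_measure K \<le> u" for u
  proof (cases u)
    case (Fin e)
    have "\<pi> f \<le> e" if f: "prec_set f V" for f
    proof -
      have K: "compact (supp f)" "supp f \<subseteq> V"
        using f by (auto simp: prec_set_def Cc_compact)
      have "\<pi> f \<le> open_value W" if "open W" "supp f \<subseteq> W" for W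
        using f that by (intro le_open_value) (auto simp: prec_set_def)
      then have "\<pi> f \<le> outer_value (supp f)"
        by (intro isGlb_greatest[OF outer_value]) auto
      also have "\<dots> \<le> e"
        using u[OF K] by (simp add: operator_measure_compact[OF K(1)] Fin)
      finally show ?thesis .
    qed
    then show ?thesis
      by (simp add: operator_measure_open[OF V] Fin open_value_le)
  qed simp
  have upper: "operator_measure K \<le> operator_measure V" if "compact K" "K \<subseteq> V" for K
    using that V
    by (simp add: operator_measure_compact operator_measure_open outer_value_le)
  show ?thesis
    unfolding inner_regular_at_def
  proof (rule isLubI)
    fix u assume "\<And>x. x \<in> {operator_measure K |K. compact K \<and> K \<subseteq> V} \<Longrightarrow> x \<le> u"
    then show "operator_measure V \<le> u" by (intro least) blast
  qed (use upper in blast)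
qed

lemma regular_operator_measure: "regular_borel_measure operator_measure"
  unfolding regular_borel_measure_def
proof (intro conjI allI impI ballI)
  fix A :: "'x set" assume A: "A \<in> sets borel"
  have "{operator_measure V |V. open V \<and> A \<subseteq> V} = Fin ` open_value ` {V. open V \<and> A \<subseteq> V}"
    by (auto simp: operator_measure_open) (metis operator_measure_open)
  \<comment> \<open>The whole space is always an open superset, which keeps \<open>Infty\<close>
    from being a lower bound.\<close>
  moreover have "open_value ` {V. open V \<and> A \<subseteq> V} \<noteq> {}" by auto
  ultimately show "outer_regular_at operator_measure A"
    using outer_value[of A] A by (simp add: outer_regular_at_def isGlb_Fin operator_measure_def)
qed (auto simp: ext_measure_operator_measure operator_measure_compact inner_regular_operator_measure)

text \<open>Two scalar measures belong to each functional: the Riesz measure of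
  \<open>\<psi> \<circ> \<pi>\<close> and the trace of the vector-valued measure on the whole space.
  They agree on Borel sets, so both sides have the same image under every \<open>\<psi>\<close>, and
  normality concludes.\<close>

lemma represents_operator_measure: "represents operator_measure \<pi>"
  unfolding represents_def
proof (intro ballI conjI)
  fix f :: "'x \<Rightarrow> real" assume f: "f \<in> Cc"
  interpret ext_measure_on operator_measure UNIV "open_value UNIV"
    by unfold_locales (auto simp: ext_measure_operator_measure operator_measure_open)
  note int = order_integral_Cc[OF mc nm ext_measure_on_axioms f subset_UNIV]
  show "order_integrable operator_measure f" by (rule int(1))
  show "\<pi> f = order_integral operator_measure f"
  proof (rule normal_eqI[OF nm])
    fix \<psi> :: "'e \<Rightarrow> real" assume \<psi>: "oc_functional \<psi>"
    interpret R: bounded_positive_Cc_functional "\<lambda>f. \<psi> (\<pi> f)" "\<psi> b"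
      by (rule functional_bounded[OF \<psi>])
    have "R.riesz_measure = trace_measure \<psi> operator_measure UNIV"
      using measure_outer[OF \<psi>]
      by (intro measure_eqI)
        (auto simp: emeasure_trace[OF \<psi>] R.emeasure_eq_measure operator_measure_def)
    then show "\<psi> (\<pi> f) = \<psi> (order_integral operator_measure f)"
      using functional_integral[OF \<psi> f] int(2)[OF \<psi>] by simp
  qed
qed

end

theorem theorem5p4:
  fixes \<pi> :: "('x::t2_space \<Rightarrow> real) \<Rightarrow> 'e::ordered_real_vector"
  assumes "locally_compact_space (euclidean :: 'x topology)"
    and "monotone_complete TYPE('e)"
    and "normal_space_order TYPE('e)"
    and "positive_operator_Cc \<pi>"
  shows
    "(compact (UNIV :: 'x set) \<longrightarrow>
        bdd_above {\<pi> f |f. f \<in> Cc \<and> (\<forall>x. 0 \<le> f x) \<and> sup_norm f \<le> 1}) \<and>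
     (bdd_above {\<pi> f |f. f \<in> Cc \<and> (\<forall>x. 0 \<le> f x) \<and> sup_norm f \<le> 1} \<longrightarrow>
        (\<exists>!\<mu>. regular_borel_measure \<mu> \<and> represents \<mu> \<pi>) \<and>
        (\<forall>\<mu>. regular_borel_measure \<mu> \<and> represents \<mu> \<pi> \<longrightarrow>
           finite_ext_measure \<mu> \<and>
           (\<forall>V. open V \<and> V \<noteq> {} \<longrightarrow>
              (\<exists>v. \<mu> V = Fin v \<and> isLub UNIV {\<pi> f |f. prec_set f V} v)) \<and>
           (\<forall>K. compact K \<longrightarrow>
              (\<exists>k. \<mu> K = Fin k \<and> isGlb UNIV {\<pi> f |f. set_prec K f} k))))"
proof (intro conjI impI)
  assume "compact (UNIV :: 'x set)"
  \<comment> \<open>On a compact space the constant 1 has compact support and dominates the unit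
    ball, so its image is the required bound.\<close>
  then have one: "(\<lambda>x::'x. 1) \<in> Cc"
    by (rule CcI[OF continuous_on_const _ subset_UNIV])
  have "\<pi> f \<le> \<pi> (\<lambda>x. 1)" if "f \<in> Cc" "sup_norm f \<le> 1" for f
    by (rule positive_operator_mono[OF assms(4) that(1) one sup_norm_le_one[OF that]])
  then show "bdd_above {\<pi> f |f. f \<in> Cc \<and> (\<forall>x. 0 \<le> f x) \<and> sup_norm f \<le> 1}"
    by (intro bdd_aboveI[of _ "\<pi> (\<lambda>x. 1)"]) auto
next
  assume bdd: "bdd_above {\<pi> f |f. f \<in> Cc \<and> (\<forall>x. 0 \<le> f x) \<and> sup_norm f \<le> 1}"
  then obtain b where b: "\<And>f. f \<in> Cc \<Longrightarrow> \<forall>x. 0 \<le> f x \<Longrightarrow> sup_norm f \<le> 1 \<Longrightarrow> \<pi> f \<le> b"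
    by (auto simp: bdd_above_def)
  interpret bounded_positive_operator \<pi> b
    using assms b prec_set_sup_norm by unfold_locales (auto simp: prec_set_def)
  show "\<exists>!\<mu>. regular_borel_measure \<mu> \<and> represents \<mu> \<pi>"
  proof (rule ex1I[of _ operator_measure])
    show *: "regular_borel_measure operator_measure \<and> represents operator_measure \<pi>"
      by (intro conjI regular_operator_measure represents_operator_measure)
    show "\<mu> = operator_measure" if "regular_borel_measure \<mu> \<and> represents \<mu> \<pi>" for \<mu>
      by (rule representing_unique[OF assms(1-3)]) (use that * in auto)
  qed
  show "\<forall>\<mu>. regular_borel_measure \<mu> \<and> represents \<mu> \<pi> \<longrightarrow>
     finite_ext_measure \<mu> \<and>
     (\<forall>V. open V \<and> V \<noteq> {} \<longrightarrow> (\<exists>v. \<mu> V = Fin v \<and> isLub UNIV {\<pi> f |f. prec_set f V} v)) \<and>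
     (\<forall>K. compact K \<longrightarrow> (\<exists>k. \<mu> K = Fin k \<and> isGlb UNIV {\<pi> f |f. set_prec K f} k))"
  proof (intro allI impI conjI; elim conjE)
    fix \<mu> assume \<mu>: "regular_borel_measure \<mu>" "represents \<mu> \<pi>"
    show "finite_ext_measure \<mu>"
      by (rule representing_finite[OF assms(1-3) \<mu> bdd])
    show "\<exists>v. \<mu> V = Fin v \<and> isLub UNIV {\<pi> f |f. prec_set f V} v" if "open V" for V
      by (rule representing_open_finite[OF assms(1-3) \<mu> bdd that])
    show "\<exists>k. \<mu> K = Fin k \<and> isGlb UNIV {\<pi> f |f. set_prec K f} k" if "compact K" for K
      by (rule representing_compact[OF assms(1-3) \<mu> that])
  qed
qed

end
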